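(* There exists a semi-streaming algorithm that makes $3$ passes over the input stream and, for every (general) undirected graph $G=(V,E)$, outputs a matching of $G$ whose size is at least $\left(\frac{1}{2}+\frac{1}{14.4}\right)$ times the size of a maximum matching of $G$.
   Context: Maximum matching problem in the data stream model: the input is an unweighted undirected graph $G=(V,E)$ with $n$ vertices; the vertex set $V$ is known in advance, and the edges of $E$ arrive one by one in an arbitrary order (the input stream). A $p$-pass algorithm reads this stream sequentially $p$ times and may perform arbitrary computation after each edge. A semi-streaming algorithm is one using space $O(n\log^c n)$ for some constant $c\ge 0$ (a vertex or edge occupies $O(\log n)$ bits). *)

theory Defs
  imports Complex_Main "HOL-Library.Landau_Symbols"
begin

section \<open>Graphs and matchings\<close>

text \<open>Finite simple undirected graphs; an edge is a two-element set of vertices.\<close>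

definition ugraph :: "'v set \<Rightarrow> 'v set set \<Rightarrow> bool" where
  "ugraph V E \<longleftrightarrow> finite V \<and> E \<subseteq> {{u, v} | u v. u \<in> V \<and> v \<in> V \<and> u \<noteq> v}"

definition matching :: "'v set set \<Rightarrow> 'v set set \<Rightarrow> bool" where
  "matching E M \<longleftrightarrow> M \<subseteq> E \<and> (\<forall>e\<in>M. \<forall>f\<in>M. e \<noteq> f \<longrightarrow> e \<inter> f = {})"

definition maximum_matching :: "'v set set \<Rightarrow> 'v set set \<Rightarrow> bool" where
  "maximum_matching E M \<longleftrightarrow> matching E M \<and> (\<forall>M'. matching E M' \<longrightarrow> card M' \<le> card M)"

section \<open>Multi-pass streaming algorithms\<close>

definition edge_stream :: "'v set set \<Rightarrow> 'v set list \<Rightarrow> bool" where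
  "edge_stream E es \<longleftrightarrow> distinct es \<and> set es = E"

text \<open>
  The memory of an algorithm is a bit string, and its space is the length of that string.
  Every component receives the vertex set, which is known in advance and not charged as memory.
  The functions are arbitrary because the computation between two reads of the stream is not
  restricted; what is restricted is the memory carried from one read to the next. In particular
  the number of the current pass is not supplied: an algorithm that needs it has to store it,
  which it can update in \<open>end_pass\<close>. The output depends on the final memory only.
\<close>

record 'v streaming_algorithm =
  initial :: "'v set \<Rightarrow> bool list"
  process :: "'v set \<Rightarrow> bool list \<Rightarrow> 'v set \<Rightarrow> bool list"
  end_pass :: "'v set \<Rightarrow> bool list \<Rightarrow> bool list"
  answer :: "'v set \<Rightarrow> bool list \<Rightarrow> 'v set set"

definition run_pass ::
    "'v streaming_algorithm \<Rightarrow> 'v set \<Rightarrow> 'v set list \<Rightarrow> bool list \<Rightarrow> bool list" where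
  "run_pass A V es m = end_pass A V (foldl (process A V) m es)"

definition after_passes ::
    "'v streaming_algorithm \<Rightarrow> 'v set \<Rightarrow> 'v set list \<Rightarrow> nat \<Rightarrow> bool list" where
  "after_passes A V es i = (run_pass A V es ^^ i) (initial A V)"

text \<open>The memory after \<open>i\<close> complete passes and the first \<open>j\<close> edges of the following pass.\<close>

definition memory_at ::
    "'v streaming_algorithm \<Rightarrow> 'v set \<Rightarrow> 'v set list \<Rightarrow> nat \<Rightarrow> nat \<Rightarrow> bool list" where
  "memory_at A V es i j = foldl (process A V) (after_passes A V es i) (take j es)"

definition result ::
    "nat \<Rightarrow> 'v streaming_algorithm \<Rightarrow> 'v set \<Rightarrow> 'v set list \<Rightarrow> 'v set set" where
  "result p A V es = answer A V (after_passes A V es p)"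

definition uses_space :: "nat \<Rightarrow> 'v streaming_algorithm \<Rightarrow> (nat \<Rightarrow> nat) \<Rightarrow> bool" where
  "uses_space p A s \<longleftrightarrow>
     (\<forall>V E es. ugraph V E \<and> edge_stream E es \<longrightarrow>
        (\<forall>i<p. \<forall>j\<le>length es. length (memory_at A V es i j) \<le> s (card V)) \<and>
        length (after_passes A V es p) \<le> s (card V))"

definition semi_streaming :: "nat \<Rightarrow> 'v streaming_algorithm \<Rightarrow> bool" where
  "semi_streaming p A \<longleftrightarrow>
     (\<exists>s c. uses_space p A s \<and> c \<ge> 0 \<and>
        (\<lambda>n. real (s n)) \<in> O(\<lambda>n. real n * ln (real n) powr c))"

end

theory Submission
  imports Defs "HOL-Library.Disjoint_Sets"
begin

text \<open>
  Pass 1 builds a greedy maximal matching \<open>M0\<close>; let \<open>U\<close> be its vertex set. Pass 2 builds a greedy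
  matching \<open>M\<close> among the edges leaving \<open>U\<close> and keeps the set \<open>C\<close> of edges \<open>{v, x}\<close> that close a
  triangle with \<open>{u, v} \<in> M0\<close> and \<open>{u, x} \<in> M\<close>. Since \<open>M\<close> is greedy, a closing edge at an
  \<open>M\<close>-free vertex \<open>v\<close> cannot precede \<open>{u, x}\<close> in the stream, so \<open>C\<close> misses none of those. Pass 3
  greedily collects a set \<open>S\<close> of edges that complete augmenting paths of length three, for
  edges of \<open>M0\<close> with exactly one \<open>M\<close>-covered end: one edge of \<open>S\<close> per edge of \<open>M0\<close>, and at most
  two edges of \<open>S\<close> per vertex outside \<open>U\<close>. The closing edges allow either end of a triangle to be
  extended, so triangles cost nothing. The output is a maximum matching of the stored edges.

  Let \<open>m = |M0|\<close>, let \<open>o\<close> be the optimum, \<open>k\<close> the number of \<open>M0\<close>-edges both of whose ends are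
  matched outside \<open>U\<close> by the optimum, \<open>d\<close> the number of \<open>M0\<close>-edges with both ends covered by \<open>M\<close>,
  and \<open>g\<close> the number of those among the \<open>k\<close> with exactly one covered end. Then
  \<open>k \<ge> 2 o - 3 m\<close>, \<open>2 g + 4 d \<ge> 3 k - m\<close> and \<open>3 |S| \<ge> 2 g\<close>. One can augment by \<open>d\<close> disjoint paths
  from \<open>M\<close>, or by \<open>|S| / 3\<close> disjoint paths from \<open>S\<close>, and the better choice gives a matching
  of size at least \<open>(6 o + 3 m) / 13 \<ge> (15 / 26) o\<close>, which exceeds \<open>(1 / 2 + 1 / 14.4) o\<close>.
\<close>

section \<open>Matchings and simultaneous augmentation along paths of length three\<close>

lemma matching_iff_disjoint: "matching E M \<longleftrightarrow> M \<subseteq> E \<and> disjoint M"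
  by (auto simp: matching_def disjoint_def)

lemma exists_maximum_matching:
  assumes "finite E"
  shows "\<exists>M. maximum_matching E M"
proof -
  have "\<exists>M. matching E M \<and> (\<forall>M'. matching E M' \<longrightarrow> card M' \<le> card M)"
  proof (rule ex_has_greatest_nat[of _ _ _ "Suc (card E)"])
    show "matching E {}" by (simp add: matching_def)
    show "\<forall>M. matching E M \<longrightarrow> card M < Suc (card E)"
      using assms by (auto simp: matching_def less_Suc_eq_le intro: card_mono)
  qed
  then show ?thesis by (simp add: maximum_matching_def)
qed

text \<open>Turns counts per edge into counts of vertices; the double counts over \<open>M0\<close>,
  \<open>M\<close> and the optimum go through it.\<close>

lemma card_Int_Union_disjoint:
  assumes "finite M" "disjoint M" "finite A"
  shows "card (A \<inter> \<Union>M) = (\<Sum>e\<in>M. card (A \<inter> e))"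
proof -
  have "A \<inter> \<Union>M = (\<Union>e\<in>M. A \<inter> e)" by blast
  also have "card \<dots> = (\<Sum>e\<in>M. card (A \<inter> e))"
    using assms by (intro card_UN_disjoint) (auto simp: disjoint_def)
  finally show ?thesis .
qed

text \<open>The middle edge of the path \<open>a - u - v - b\<close> is exchanged for the two outer
  ones. Old vertices stay covered and only \<open>a\<close> and \<open>b\<close> are new, so the
  exchange can be iterated.\<close>

lemma matching_augment_path:
  assumes "disjoint M" "finite M" "{u, v} \<in> M" "u \<noteq> v" "a \<notin> \<Union>M" "b \<notin> \<Union>M" "a \<noteq> b"
  defines "M' \<equiv> insert {a, u} (insert {v, b} (M - {{u, v}}))"
  shows "disjoint M'" "card M' = Suc (card M)" "\<Union>M' = \<Union>M \<union> {a, b}"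
proof -
  have sep: "u \<notin> f \<and> v \<notin> f \<and> a \<notin> f \<and> b \<notin> f" if "f \<in> M - {{u, v}}" for f
  proof -
    have "f \<inter> {u, v} = {}" using disjointD[OF assms(1), of f "{u, v}"] that assms(3) by simp
    moreover have "f \<subseteq> \<Union>M" using that by blast
    ultimately show ?thesis using assms(5,6) by blast
  qed
  have new: "a \<noteq> u" "a \<noteq> v" "b \<noteq> u" "b \<noteq> v" using assms(3,5,6) by blast+
  have ends: "{a, u} \<inter> {v, b} = {}" using new assms(4,7) by auto
  show "disjoint M'"
    unfolding disjoint_def
  proof (intro ballI impI)
    fix e f
    assume e: "e \<in> M'" and f: "f \<in> M'" and "e \<noteq> f"
    have old: "g \<inter> h = {}" if "g \<in> {{a, u}, {v, b}}" "h \<in> M - {{u, v}}" for g h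
    proof -
      have "g \<subseteq> {a, b, u, v}" using that(1) by auto
      then show ?thesis using sep[OF that(2)] by blast
    qed
    have "g \<in> {{a, u}, {v, b}} \<or> g \<in> M - {{u, v}}" if "g \<in> M'" for g
      using that unfolding M'_def by (elim insertE) simp_all
    from this[OF e] this[OF f]
    consider "e \<in> M - {{u, v}}" "f \<in> M - {{u, v}}"
      | "e \<in> {{a, u}, {v, b}}" "f \<in> M - {{u, v}}"
      | "e \<in> M - {{u, v}}" "f \<in> {{a, u}, {v, b}}"
      | "e \<in> {{a, u}, {v, b}}" "f \<in> {{a, u}, {v, b}}"
      by argo
    then show "e \<inter> f = {}"
    proof cases
      case 1
      then show ?thesis using disjointD[OF assms(1), of e f] \<open>e \<noteq> f\<close> by simp
    next
      case 2
      then show ?thesis by (rule old)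
    next
      case 3
      then show ?thesis using old[of f e] by (simp add: Int_commute)
    next
      case 4
      then have "e = {a, u} \<and> f = {v, b} \<or> e = {v, b} \<and> f = {a, u}"
        using \<open>e \<noteq> f\<close> by (elim insertE emptyE) simp_all
      then show ?thesis using ends by (metis Int_commute)
    qed
  qed
  have "{a, u} \<notin> M - {{u, v}}" "{v, b} \<notin> M - {{u, v}}" "{a, u} \<noteq> {v, b}"
    using sep[of "{a, u}"] sep[of "{v, b}"] ends by auto
  then have "card M' = Suc (Suc (card (M - {{u, v}})))"
    using assms(2) by (simp add: M'_def)
  also have "card (M - {{u, v}}) = card M - 1" using assms(2,3) by simp
  also have "Suc (Suc (card M - 1)) = Suc (card M)"
    using assms(2,3) by (metis Suc_pred card_gt_0_iff diff_Suc_1 empty_iff)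
  finally show "card M' = Suc (card M)" .
  have "\<Union>M = {u, v} \<union> \<Union>(M - {{u, v}})" using assms(3) by blast
  then show "\<Union>M' = \<Union>M \<union> {a, b}" unfolding M'_def by (simp, blast)
qed

text \<open>One exchange at a time, by induction over the paths. The last two conjuncts strengthen
  the induction: the vertex set shows that the ends of the next path are still free, the inclusion
  that its middle edge is still present.\<close>

lemma matching_augment_paths:
  assumes "finite I" "disjoint M" "finite M" "M \<subseteq> E"
    and "\<And>i. i \<in> I \<Longrightarrow> {u i, v i} \<in> M \<and> u i \<noteq> v i \<and> a i \<notin> \<Union>M \<and> b i \<notin> \<Union>M \<and> a i \<noteq> b i
                    \<and> {a i, u i} \<in> E \<and> {v i, b i} \<in> E"
    and "\<And>i j. i \<in> I \<Longrightarrow> j \<in> I \<Longrightarrow> i \<noteq> j \<Longrightarrow> {u i, v i} \<noteq> {u j, v j} \<and> {a i, b i} \<inter> {a j, b j} = {}"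
  shows "\<exists>N. matching E N \<and> finite N \<and> card N = card M + card I \<and> \<Union>N = \<Union>M \<union> (\<Union>i\<in>I. {a i, b i})
    \<and> M - (\<lambda>i. {u i, v i}) ` I \<subseteq> N"
  using assms(1,5,6)
proof (induction I rule: finite_induct)
  case empty
  show ?case using assms(2,3,4) by (intro exI[of _ M]) (auto simp: matching_iff_disjoint)
next
  case (insert i I)
  have "\<exists>N. matching E N \<and> finite N \<and> card N = card M + card I \<and> \<Union>N = \<Union>M \<union> (\<Union>i\<in>I. {a i, b i})
    \<and> M - (\<lambda>i. {u i, v i}) ` I \<subseteq> N"
    by (rule insert.IH) (use insert.prems in auto)
  then obtain N where N: "matching E N" "finite N" "card N = card M + card I"
    "\<Union>N = \<Union>M \<union> (\<Union>i\<in>I. {a i, b i})" "M - (\<lambda>i. {u i, v i}) ` I \<subseteq> N"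
    by blast
  have i: "{u i, v i} \<in> M" "u i \<noteq> v i" "a i \<notin> \<Union>M" "b i \<notin> \<Union>M" "a i \<noteq> b i"
    "{a i, u i} \<in> E" "{v i, b i} \<in> E"
    using insert.prems(1)[of i] by auto
  have other: "{u i, v i} \<noteq> {u j, v j} \<and> {a i, b i} \<inter> {a j, b j} = {}" if "j \<in> I" for j
    using insert.prems(2)[of i j] that insert.hyps(2) by auto
  have iN: "{u i, v i} \<in> N" using i(1) other N(5) by blast
  have ab: "a i \<notin> \<Union>N" "b i \<notin> \<Union>N"
    using i(3,4) other unfolding N(4) by (blast, blast)
  define N' where "N' = insert {a i, u i} (insert {v i, b i} (N - {{u i, v i}}))"
  have "disjoint N" using N(1) by (simp add: matching_iff_disjoint)
  note N' = matching_augment_path[OF this N(2) iN i(2) ab i(5), folded N'_def]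
  have "matching E N'"
    using N'(1) N(1) i(6,7) by (auto simp: matching_iff_disjoint N'_def)
  moreover have "M - (\<lambda>i. {u i, v i}) ` insert i I \<subseteq> N'"
    using N(5) by (auto simp: N'_def)
  moreover have "finite N'" using N(2) by (simp add: N'_def)
  moreover have "card N' = card M + card (insert i I)"
    using N'(2) N(3) insert.hyps by simp
  moreover have "\<Union>N' = \<Union>M \<union> (\<Union>i\<in>insert i I. {a i, b i})"
    using N'(3) N(4) by auto
  ultimately show ?case by blast
qed

text \<open>
  The pairs \<open>{x i, y i}\<close> form a pseudoforest: each edge is owned by its end \<open>x i\<close>. An owner that
  is nobody's target is a leaf whose neighbour meets at most three edges; without such an owner,
  \<open>y\<close> permutes the owners and every edge meets two others at most.
\<close>

lemma disjoint_pairs_third: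
  fixes x y :: "'i \<Rightarrow> 'a"
  assumes "finite D" "inj_on x D" "\<And>i. i \<in> D \<Longrightarrow> x i \<noteq> y i"
    and "\<And>z. card {i \<in> D. y i = z} \<le> 2"
  shows "\<exists>C\<subseteq>D. card D \<le> 3 * card C \<and> (\<forall>i\<in>C. \<forall>j\<in>C. i \<noteq> j \<longrightarrow> {x i, y i} \<inter> {x j, y j} = {})"
  using assms
proof (induction D rule: finite_psubset_induct)
  case (psubset D)
  show ?case
  proof (cases "D = {}")
    case True
    then show ?thesis by (intro exI[of _ "{}"]) auto
  next
    case False
    \<comment> \<open>\<open>B i\<close> collects the pairs meeting pair \<open>i\<close>, including
      \<open>i\<close> itself. Once some \<open>B i\<close> has at most three members, keeping
      \<open>i\<close>, discarding the rest of \<open>B i\<close> and recursing loses only a factor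
      of 3.\<close>
    define B where "B i = {j \<in> D. {x i, y i} \<inter> {x j, y j} \<noteq> {}}" for i
    have owner: "card {j \<in> D. x j = z} \<le> 1" for z
      using psubset.prems(1) psubset.hyps
      by (subst card_le_Suc0_iff_eq[unfolded One_nat_def[symmetric]]) (auto simp: inj_on_def)
    have "\<exists>i\<in>D. card (B i) \<le> 3"
    proof (cases "\<exists>i\<in>D. x i \<notin> y ` D")
      case True
      then obtain i where i: "i \<in> D" "x i \<notin> y ` D" by blast
      have "B i \<subseteq> {j \<in> D. y j = y i} \<union> {j \<in> D. x j = y i}"
      proof
        fix j
        assume "j \<in> B i"
        then have j: "j \<in> D" "{x i, y i} \<inter> {x j, y j} \<noteq> {}" by (simp_all add: B_def)
        have "x i \<noteq> y j" using i(2) j(1) by blast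
        moreover have "j = i" if "x i = x j"
          using inj_onD[OF psubset.prems(1) that i(1) j(1)] by simp
        ultimately show "j \<in> {j \<in> D. y j = y i} \<union> {j \<in> D. x j = y i}"
          using j by auto
      qed
      then have "card (B i) \<le> card {j \<in> D. y j = y i} + card {j \<in> D. x j = y i}"
        using psubset.hyps
        by (intro order_trans[OF card_mono card_Un_le]) auto
      with psubset.prems(3)[of "y i"] owner[of "y i"] i(1) show ?thesis by (intro bexI[of _ i]) linarith+
    next
      case False
      then have sub: "x ` D \<subseteq> y ` D" by blast
      have cx: "card (x ` D) = card D" using psubset.prems(1) by (rule card_image)
      have "card (y ` D) = card D"
        using card_mono[OF _ sub] card_image_le[OF psubset.hyps, of y] cx psubset.hyps by simp
      then have injy: "inj_on y D" using psubset.hyps by (simp add: eq_card_imp_inj_on)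
      obtain i where i: "i \<in> D" using \<open>D \<noteq> {}\<close> by blast
      have "B i \<subseteq> {i} \<union> {j \<in> D. y j = x i} \<union> {j \<in> D. x j = y i}"
      proof
        fix j
        assume "j \<in> B i"
        then have j: "j \<in> D" "{x i, y i} \<inter> {x j, y j} \<noteq> {}" by (simp_all add: B_def)
        have "j = i" if "x i = x j"
          using inj_onD[OF psubset.prems(1) that i j(1)] by simp
        moreover have "j = i" if "y i = y j"
          using inj_onD[OF injy that i j(1)] by simp
        ultimately show "j \<in> {i} \<union> {j \<in> D. y j = x i} \<union> {j \<in> D. x j = y i}"
          using j by auto
      qed
      then have "card (B i) \<le> card ({i} \<union> {j \<in> D. y j = x i} \<union> {j \<in> D. x j = y i})"
        using psubset.hyps by (intro card_mono) auto
      also have "\<dots> \<le> card {i} + card {j \<in> D. y j = x i} + card {j \<in> D. x j = y i}"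
        by (intro order_trans[OF card_Un_le] add_mono card_Un_le order_refl)
      also have "card {j \<in> D. y j = x i} \<le> 1"
        using injy psubset.hyps
        by (subst card_le_Suc0_iff_eq[unfolded One_nat_def[symmetric]]) (auto simp: inj_on_def)
      finally show ?thesis using owner[of "y i"] i by (intro bexI[of _ i]) auto
    qed
    then obtain i where i: "i \<in> D" "card (B i) \<le> 3" by blast
    have iB: "i \<in> B i" using i(1) by (simp add: B_def)
    have less: "D - B i \<subset> D" using iB i(1) by blast
    have "\<exists>C\<subseteq>D - B i. card (D - B i) \<le> 3 * card C
        \<and> (\<forall>i\<in>C. \<forall>j\<in>C. i \<noteq> j \<longrightarrow> {x i, y i} \<inter> {x j, y j} = {})"
    proof (rule psubset.IH[OF less])
      show "inj_on x (D - B i)" using psubset.prems(1) by (rule inj_on_subset) blast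
      show "card {j \<in> D - B i. y j = z} \<le> 2" for z
      proof -
        have "card {j \<in> D - B i. y j = z} \<le> card {j \<in> D. y j = z}"
          using psubset.hyps by (intro card_mono) auto
        then show ?thesis using psubset.prems(3)[of z] by linarith
      qed
    qed (use psubset.prems(2) in auto)
    then obtain C where C: "C \<subseteq> D - B i" "card (D - B i) \<le> 3 * card C"
      "\<And>i j. i \<in> C \<Longrightarrow> j \<in> C \<Longrightarrow> i \<noteq> j \<Longrightarrow> {x i, y i} \<inter> {x j, y j} = {}" by blast
    have BD: "B i \<subseteq> D" by (auto simp: B_def)
    have "finite C" using C(1) psubset.hyps by (meson finite_Diff finite_subset)
    moreover have "i \<notin> C" using C(1) iB by blast
    moreover have "card (D - B i) = card D - card (B i)"
      using BD psubset.hyps by (meson card_Diff_subset finite_subset)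
    ultimately have "card D \<le> 3 * card (insert i C)" using C(2) i(2) by simp
    moreover have "\<forall>k\<in>insert i C. \<forall>j\<in>insert i C. k \<noteq> j \<longrightarrow> {x k, y k} \<inter> {x j, y j} = {}"
    proof (intro ballI impI)
      fix k j
      assume kj: "k \<in> insert i C" "j \<in> insert i C" "k \<noteq> j"
      have sep: "{x i, y i} \<inter> {x l, y l} = {}" if "l \<in> C" for l
        using that C(1) by (auto simp: B_def)
      show "{x k, y k} \<inter> {x j, y j} = {}"
      proof (cases "k = i")
        case True
        then show ?thesis using sep[of j] kj by simp
      next
        case False
        show ?thesis
        proof (cases "j = i")
          case True
          then show ?thesis using sep[of k] kj by (simp add: Int_commute)
        next
          case False
          then show ?thesis using C(3)[of k j] kj \<open>k \<noteq> i\<close> by simp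
        qed
      qed
    qed
    moreover have "insert i C \<subseteq> D" using C(1) i(1) by blast
    ultimately show ?thesis by blast
  qed
qed

section \<open>Bit strings as memory\<close>

text \<open>Reduces bit-string memory to counting: at most \<open>2 ^ s\<close> states embed into
  the bit strings of length \<open>s\<close>, by an encoding that depends on \<open>V\<close> alone.
  Membership in \<open>states\<close> is asked only along runs on genuine streams, not as closure
  under \<open>step\<close>, because the sparsity of the stored sets comes from the way a run builds
  them.\<close>

lemma exists_streaming_algorithm:
  fixes init :: "'v set \<Rightarrow> 's" and step :: "'v set \<Rightarrow> 's \<Rightarrow> 'v set \<Rightarrow> 's"
    and fin :: "'v set \<Rightarrow> 's \<Rightarrow> 's" and out :: "'v set \<Rightarrow> 's \<Rightarrow> 'v set set"
    and states :: "'v set \<Rightarrow> 's set"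
  defines "passes \<equiv> \<lambda>V es i. ((\<lambda>st. fin V (foldl (step V) st es)) ^^ i) (init V)"
  assumes card: "\<And>V. finite V \<Longrightarrow> finite (states V) \<and> card (states V) \<le> 2 ^ s (card V)"
    and reach: "\<And>V E es i j. \<lbrakk>ugraph V E; edge_stream E es; i < p; j \<le> length es\<rbrakk> \<Longrightarrow>
      foldl (step V) (passes V es i) (take j es) \<in> states V"
    and reach_end: "\<And>V E es. \<lbrakk>ugraph V E; edge_stream E es\<rbrakk> \<Longrightarrow> passes V es p \<in> states V"
  shows "\<exists>A. uses_space p A s \<and> (\<forall>V E es. ugraph V E \<and> edge_stream E es \<longrightarrow>
    result p A V es = out V (passes V es p))"
proof -
  \<comment> \<open>The condition \<open>finite V\<close> sits under the existential quantifier so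
    that an encoding can be chosen for all \<open>V\<close> at once.\<close>
  have "\<exists>f. finite V \<longrightarrow> inj_on f (states V) \<and> f ` states V \<subseteq> {l :: bool list. length l = s (card V)}" for V
  proof (cases "finite V")
    case True
    have "card {l :: bool list. length l = s (card V)} = 2 ^ s (card V)"
      using card_lists_length_eq[of "UNIV :: bool set" "s (card V)"] by simp
    moreover have "finite {l :: bool list. length l = s (card V)}"
      using finite_lists_length_eq[of "UNIV :: bool set" "s (card V)"] by simp
    ultimately show ?thesis
      using card[OF True] card_le_inj[of "states V" "{l :: bool list. length l = s (card V)}"]
      by auto
  qed auto
  then obtain enc where enc: "\<And>V. finite V \<Longrightarrow> inj_on (enc V) (states V)"
    "\<And>V. finite V \<Longrightarrow> enc V ` states V \<subseteq> {l :: bool list. length l = s (card V)}"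
    by metis
  define dec where "dec V = inv_into (states V) (enc V)" for V
  have dec: "dec V (enc V st) = st" if "finite V" "st \<in> states V" for V st
    using that enc(1) by (simp add: dec_def)
  define A where "A = \<lparr>initial = \<lambda>V. enc V (init V),
    process = \<lambda>V m e. enc V (step V (dec V m) e),
    end_pass = \<lambda>V m. enc V (fin V (dec V m)),
    answer = \<lambda>V m. out V (dec V m)\<rparr>"
  \<comment> \<open>Every read decodes the memory first, so each intermediate state, not just the
    last, must lie where \<open>dec\<close> inverts \<open>enc\<close>.\<close>
  have sim: "foldl (process A V) (enc V st) es = enc V (foldl (step V) st es)"
    if "finite V" "\<And>j. j \<le> length es \<Longrightarrow> foldl (step V) st (take j es) \<in> states V"
    for V :: "'v set" and st es
    using that(2)
  proof (induction es rule: rev_induct)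
    case (snoc e es)
    have "foldl (step V) st (take j es) \<in> states V" if "j \<le> length es" for j
      using snoc.prems[of j] that by simp
    moreover from this[of "length es"] have "foldl (step V) st es \<in> states V" by simp
    ultimately show ?case
      using snoc.IH dec[OF that(1)] by (simp add: A_def)
  qed simp
  have after: "after_passes A V es i = enc V (passes V es i)"
    if "ugraph V E" "edge_stream E es" "i \<le> p" for V E es i
    using that(3)
  proof (induction i)
    case 0
    then show ?case by (simp add: after_passes_def passes_def A_def)
  next
    case (Suc i)
    have V: "finite V" using that(1) by (simp add: ugraph_def)
    have r: "foldl (step V) (passes V es i) (take j es) \<in> states V" if "j \<le> length es" for j
      using reach[of V E es i j] \<open>ugraph V E\<close> \<open>edge_stream E es\<close> Suc.prems that by simp
    have "after_passes A V es (Suc i) = end_pass A V (foldl (process A V) (enc V (passes V es i)) es)"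
      using Suc by (simp add: after_passes_def run_pass_def)
    also have "\<dots> = end_pass A V (enc V (foldl (step V) (passes V es i) es))"
      by (subst sim[OF V r]) auto
    also have "\<dots> = enc V (passes V es (Suc i))"
      using dec[OF V] r[of "length es"] by (simp add: A_def passes_def)
    finally show ?case .
  qed
  have "uses_space p A s"
    unfolding uses_space_def
  proof (intro allI impI conjI)
    fix V :: "'v set" and E es i j
    assume g: "ugraph V E \<and> edge_stream E es" and ij: "i < p" "j \<le> length es"
    have V: "finite V" using g by (simp add: ugraph_def)
    have r: "foldl (step V) (passes V es i) (take k es) \<in> states V" if "k \<le> length es" for k
      using reach[of V E es i k] g ij that by simp
    have "memory_at A V es i j = foldl (process A V) (enc V (passes V es i)) (take j es)"
      unfolding memory_at_def using after[of V E es i] g ij by simp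
    also have "\<dots> = enc V (foldl (step V) (passes V es i) (take j es))"
    proof (rule sim[OF V])
      show "foldl (step V) (passes V es i) (take k (take j es)) \<in> states V"
        if "k \<le> length (take j es)" for k
        using that ij r[of k] by (simp add: min_absorb1)
    qed
    finally show "length (memory_at A V es i j) \<le> s (card V)"
      using enc(2)[OF V] r[OF ij(2)] by auto
  next
    fix V :: "'v set" and E es
    assume g: "ugraph V E \<and> edge_stream E es"
    then have V: "finite V" by (simp add: ugraph_def)
    show "length (after_passes A V es p) \<le> s (card V)"
      using after[of V E es p] reach_end[of V E es] g enc(2)[OF V] by auto
  qed
  moreover have "result p A V es = out V (passes V es p)"
    if "ugraph V E" "edge_stream E es" for V E es
    using after[OF that] reach_end[OF that] that(1) dec[of V]
    by (simp add: result_def A_def ugraph_def)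
  ultimately show ?thesis by blast
qed

section \<open>The three passes\<close>

definition greedy_step :: "'v set set \<Rightarrow> 'v set \<Rightarrow> 'v set set" where
  "greedy_step M e = (if e \<inter> \<Union>M = {} then insert e M else M)"

text \<open>A rejected edge meets the matching of that moment, which only grows; an accepted edge
  meets itself, provided that it is nonempty.\<close>

lemma greedy_pass:
  assumes "{} \<notin> set es"
  defines "M \<equiv> foldl greedy_step {} es"
  shows "M \<subseteq> set es" "disjoint M" "\<And>e. e \<in> set es \<Longrightarrow> e \<inter> \<Union>M \<noteq> {}"
proof -
  have "M \<subseteq> set es \<and> disjoint M \<and> (\<forall>e\<in>set es. e \<inter> \<Union>M \<noteq> {})"
    using assms(1) unfolding M_def
  proof (induction es rule: rev_induct)
    case (snoc e es)
    let ?M = "foldl greedy_step {} es"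
    have IH: "?M \<subseteq> set es" "disjoint ?M" "\<forall>e\<in>set es. e \<inter> \<Union>?M \<noteq> {}"
      using snoc by simp_all
    show ?case
    proof (cases "e \<inter> \<Union>?M = {}")
      case True
      have "disjoint (insert e ?M)"
        using IH(2) True by (auto simp: disjoint_def)
      moreover have "\<forall>f\<in>set (es @ [e]). f \<inter> \<Union>(insert e ?M) \<noteq> {}"
        using IH(3) snoc.prems by auto
      moreover have "insert e ?M \<subseteq> set (es @ [e])" using IH(1) by auto
      moreover have "foldl greedy_step {} (es @ [e]) = insert e ?M"
        using True by (simp add: greedy_step_def[of ?M e])
      ultimately show ?thesis by metis
    next
      case False
      then have "foldl greedy_step {} (es @ [e]) = ?M" by (simp add: greedy_step_def[of ?M e])
      then show ?thesis using IH False by auto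
    qed
  qed simp
  then show "M \<subseteq> set es" "disjoint M" "\<And>e. e \<in> set es \<Longrightarrow> e \<inter> \<Union>M \<noteq> {}" by auto
qed

definition wing :: "'v set \<Rightarrow> 'v set \<Rightarrow> bool" where
  "wing U e \<longleftrightarrow> (\<exists>u x. e = {u, x} \<and> u \<in> U \<and> x \<notin> U)"

text \<open>The third side of a triangle over an edge of \<open>M0\<close> and an edge of
  \<open>M\<close>. With it a path around \<open>{u, v}\<close> can enter from \<open>x\<close>
  through \<open>v\<close> and leave through \<open>u\<close>.\<close>

definition closes :: "'v set set \<Rightarrow> 'v set set \<Rightarrow> 'v set \<Rightarrow> bool" where
  "closes M0 M e \<longleftrightarrow> (\<exists>u v x. e = {v, x} \<and> {u, v} \<in> M0 \<and> {u, x} \<in> M \<and> x \<notin> \<Union>M0)"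

fun wing_step :: "'v set set \<Rightarrow> 'v set set \<times> 'v set set \<Rightarrow> 'v set \<Rightarrow> 'v set set \<times> 'v set set" where
  "wing_step M0 (M, C) e =
     (if wing (\<Union>M0) e \<and> e \<inter> \<Union>M = {} then (insert e M, C)
      else if closes M0 M e then (M, insert e C)
      else (M, C))"

text \<open>The last clause is the delicate one, since a closing edge is recognised only against the
  \<open>M\<close> of the moment it is read. It holds because such an edge at an
  \<open>M\<close>-free \<open>v\<close> never comes before \<open>{u, x}\<close>.\<close>

lemma wing_pass:
  assumes "foldl (wing_step M0) ({}, {}) es = (M, C)"
  shows "M \<subseteq> set es" "disjoint M" "\<And>e. e \<in> M \<Longrightarrow> wing (\<Union>M0) e"
    "\<And>e. e \<in> set es \<Longrightarrow> wing (\<Union>M0) e \<Longrightarrow> e \<inter> \<Union>M \<noteq> {}"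
    "C \<subseteq> set es" "\<And>e. e \<in> C \<Longrightarrow> closes M0 M e"
    "\<And>u v x. \<lbrakk>{v, x} \<in> set es; {u, v} \<in> M0; {u, x} \<in> M; x \<notin> \<Union>M0; v \<notin> \<Union>M\<rbrakk> \<Longrightarrow> {v, x} \<in> C"
proof -
  have "M \<subseteq> set es \<and> disjoint M \<and> (\<forall>e\<in>M. wing (\<Union>M0) e)
    \<and> (\<forall>e\<in>set es. wing (\<Union>M0) e \<longrightarrow> e \<inter> \<Union>M \<noteq> {}) \<and> C \<subseteq> set es \<and> (\<forall>e\<in>C. closes M0 M e)
    \<and> (\<forall>u v x. {v, x} \<in> set es \<longrightarrow> {u, v} \<in> M0 \<longrightarrow> {u, x} \<in> M \<longrightarrow> x \<notin> \<Union>M0 \<longrightarrow> v \<notin> \<Union>M \<longrightarrow> {v, x} \<in> C)"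
    using assms
  proof (induction es arbitrary: M C rule: rev_induct)
    case (snoc e es)
    obtain M' C' where MC': "foldl (wing_step M0) ({}, {}) es = (M', C')" by fastforce
    note IH = snoc.IH[OF MC']
    have sub: "M' \<subseteq> set es" "C' \<subseteq> set es" and disj: "disjoint M'"
      and wings: "\<And>f. f \<in> M' \<Longrightarrow> wing (\<Union>M0) f"
      and meets: "\<And>f. f \<in> set es \<Longrightarrow> wing (\<Union>M0) f \<Longrightarrow> f \<inter> \<Union>M' \<noteq> {}"
      and closing: "\<And>f. f \<in> C' \<Longrightarrow> closes M0 M' f"
      and closed: "\<And>u v x. \<lbrakk>{v, x} \<in> set es; {u, v} \<in> M0; {u, x} \<in> M'; x \<notin> \<Union>M0; v \<notin> \<Union>M'\<rbrakk> \<Longrightarrow> {v, x} \<in> C'"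
      using IH by blast+
    have MC: "wing_step M0 (M', C') e = (M, C)" using snoc.prems MC' by simp
    \<comment> \<open>Two cases suffice: \<open>M\<close> grows and \<open>C\<close> stays, or
      \<open>M\<close> stays and \<open>C\<close> may grow.\<close>
    consider (wing) "wing (\<Union>M0) e" "e \<inter> \<Union>M' = {}" "M = insert e M'" "C = C'"
      | (other) "\<not> (wing (\<Union>M0) e \<and> e \<inter> \<Union>M' = {})" "M = M'" "C = (if closes M0 M' e then insert e C' else C')"
      using MC by (auto split: if_splits)
    then show ?case
    proof cases
      case wing
      have "disjoint M" using disj wing(2) unfolding wing(3) by (auto simp: disjoint_def)
      moreover have "f \<inter> \<Union>M \<noteq> {}" if "f \<in> set (es @ [e])" "wing (\<Union>M0) f" for f
      proof (cases "f \<in> set es")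
        case True
        then show ?thesis using meets[OF _ that(2)] unfolding wing(3) by blast
      next
        case False
        then have "f = e" using that(1) by simp
        then show ?thesis using wing(1) unfolding wing(3) wing_def by blast
      qed
      moreover have "closes M0 M f" if "f \<in> C" for f
        using closing that unfolding wing(3,4) closes_def by blast
      moreover have "{v, x} \<in> C"
        if vx: "{v, x} \<in> set (es @ [e])" and uv: "{u, v} \<in> M0" and ux: "{u, x} \<in> M"
          and x: "x \<notin> \<Union>M0" and v: "v \<notin> \<Union>M" for u v x
      proof -
        have "{v, x} \<noteq> e" using v unfolding wing(3) by blast
        then have es: "{v, x} \<in> set es" using vx by simp
        have "v \<in> \<Union>M0" using uv by blast
        then have "wing (\<Union>M0) {v, x}" using x unfolding wing_def by blast
        \<comment> \<open>The earlier edge \<open>{v, x}\<close> is a wing, so it meets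
          \<open>M'\<close>; as \<open>v\<close> is free even at the end, it does so at
          \<open>x\<close>. Hence the edge just added, being disjoint from \<open>M'\<close>, is not
          \<open>{u, x}\<close>.\<close>
        from meets[OF es this] have "x \<in> \<Union>M'" using v unfolding wing(3) by blast
        then have "{u, x} \<noteq> e" using wing(2) by blast
        then have "{u, x} \<in> M'" using ux unfolding wing(3) by simp
        then show ?thesis using closed[OF es uv _ x] v unfolding wing(3,4) by blast
      qed
      moreover have "M \<subseteq> set (es @ [e])" "C \<subseteq> set (es @ [e])" using sub wing(3,4) by auto
      moreover have "wing (\<Union>M0) f" if "f \<in> M" for f using that wings wing(1,3) by blast
      ultimately show ?thesis by blast
    next
      case other
      have "{v, x} \<in> C"
        if vx: "{v, x} \<in> set (es @ [e])" and uv: "{u, v} \<in> M0" and ux: "{u, x} \<in> M"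
          and x: "x \<notin> \<Union>M0" and v: "v \<notin> \<Union>M" for u v x
      proof (cases "{v, x} = e")
        case True
        have "closes M0 M' {v, x}" using uv ux x unfolding other(2) closes_def by blast
        then show ?thesis using True other(3) by simp
      next
        case False
        then have "{v, x} \<in> C'" using closed[of v x u] vx uv ux x v unfolding other(2) by simp
        then show ?thesis using other(3) by simp
      qed
      moreover have "f \<inter> \<Union>M \<noteq> {}" if "f \<in> set (es @ [e])" "wing (\<Union>M0) f" for f
        using meets[of f] that other(1,2) by auto
      moreover have "closes M0 M f" if "f \<in> C" for f
        using closing that unfolding other(2,3) by (auto split: if_splits)
      moreover have "M \<subseteq> set (es @ [e])" "C \<subseteq> set (es @ [e])" using sub other(2,3) by auto
      ultimately show ?thesis using disj wings unfolding other(2) by blast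
    qed
  qed auto
  then show "M \<subseteq> set es" "disjoint M" "\<And>e. e \<in> M \<Longrightarrow> wing (\<Union>M0) e"
    "\<And>e. e \<in> set es \<Longrightarrow> wing (\<Union>M0) e \<Longrightarrow> e \<inter> \<Union>M \<noteq> {}"
    "C \<subseteq> set es" "\<And>e. e \<in> C \<Longrightarrow> closes M0 M e"
    "\<And>u v x. \<lbrakk>{v, x} \<in> set es; {u, v} \<in> M0; {u, x} \<in> M; x \<notin> \<Union>M0; v \<notin> \<Union>M\<rbrakk> \<Longrightarrow> {v, x} \<in> C"
    by blast+
qed

text \<open>\<open>e = {w, y}\<close> completes a path \<open>x - w' - w - y\<close> around \<open>i = {w, w'}\<close> whose first edge is stored.\<close>

definition extends ::
    "'v set set \<Rightarrow> 'v set set \<Rightarrow> 'v set set \<Rightarrow> 'v set \<Rightarrow> 'v \<Rightarrow> 'v set \<Rightarrow> bool" where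
  "extends M0 M C i y e \<longleftrightarrow> i \<in> M0 \<and> \<not> i \<subseteq> \<Union>M \<and> y \<notin> \<Union>M0 \<and>
     (\<exists>w w' x. i = {w, w'} \<and> w \<noteq> w' \<and> e = {w, y} \<and> {w', x} \<in> M \<union> C \<and> x \<noteq> y \<and> x \<notin> \<Union>M0)"

text \<open>The cap 2 on an outer vertex serves both sides of the analysis: a third of
  \<open>S\<close> still yields disjoint paths, and an edge rejected for a full vertex can be
  charged to two edges of \<open>S\<close>.\<close>

definition extend_step ::
    "'v set set \<Rightarrow> 'v set set \<Rightarrow> 'v set set \<Rightarrow> 'v set set \<Rightarrow> 'v set \<Rightarrow> 'v set set" where
  "extend_step M0 M C S e =
     (if \<exists>i y. extends M0 M C i y e \<and> i \<inter> \<Union>S = {} \<and> card {s \<in> S. y \<in> s} < 2 then insert e S else S)"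

text \<open>An extending edge has one end in \<open>\<Union>M0\<close> and one outside, so a new
  edge touches a single member of \<open>M0\<close> and raises the load of a single outer vertex.
  Both reasons for rejection persist as \<open>S\<close> grows, since \<open>extends\<close> refers
  only to the sets of the earlier passes.\<close>

lemma extend_pass:
  fixes M0 M C :: "'v set set"
  assumes "disjoint M0"
    and "foldl (extend_step M0 M C) {} es = S"
  shows "S \<subseteq> set es" "\<And>s. s \<in> S \<Longrightarrow> \<exists>i y. extends M0 M C i y s"
    "\<And>s t i. \<lbrakk>s \<in> S; t \<in> S; i \<in> M0; s \<inter> i \<noteq> {}; t \<inter> i \<noteq> {}\<rbrakk> \<Longrightarrow> s = t"
    "\<And>y. y \<notin> \<Union>M0 \<Longrightarrow> card {s \<in> S. y \<in> s} \<le> 2"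
    "\<And>e i y. \<lbrakk>e \<in> set es; extends M0 M C i y e\<rbrakk> \<Longrightarrow> i \<inter> \<Union>S \<noteq> {} \<or> 2 \<le> card {s \<in> S. y \<in> s}"
proof -
  have "S \<subseteq> set es \<and> (\<forall>s\<in>S. \<exists>i y. extends M0 M C i y s)
    \<and> (\<forall>s\<in>S. \<forall>t\<in>S. \<forall>i\<in>M0. s \<inter> i \<noteq> {} \<longrightarrow> t \<inter> i \<noteq> {} \<longrightarrow> s = t)
    \<and> (\<forall>y. y \<notin> \<Union>M0 \<longrightarrow> card {s \<in> S. y \<in> s} \<le> 2)
    \<and> (\<forall>e\<in>set es. \<forall>i y. extends M0 M C i y e \<longrightarrow> i \<inter> \<Union>S \<noteq> {} \<or> 2 \<le> card {s \<in> S. y \<in> s})"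
    unfolding assms(2)[symmetric]
  proof (induction es rule: rev_induct)
    case (snoc e es)
    define T where "T = foldl (extend_step M0 M C) {} es"
    have sub: "T \<subseteq> set es" and ext: "\<And>s. s \<in> T \<Longrightarrow> \<exists>i y. extends M0 M C i y s"
      and uniq: "\<And>s t i. \<lbrakk>s \<in> T; t \<in> T; i \<in> M0; s \<inter> i \<noteq> {}; t \<inter> i \<noteq> {}\<rbrakk> \<Longrightarrow> s = t"
      and load: "\<And>y. y \<notin> \<Union>M0 \<Longrightarrow> card {s \<in> T. y \<in> s} \<le> 2"
      and maximal: "\<And>e i y. \<lbrakk>e \<in> set es; extends M0 M C i y e\<rbrakk> \<Longrightarrow> i \<inter> \<Union>T \<noteq> {} \<or> 2 \<le> card {s \<in> T. y \<in> s}"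
      using snoc.IH unfolding T_def by blast+
    have finT: "finite T" using sub finite_subset by blast
    have S: "foldl (extend_step M0 M C) {} (es @ [e]) = extend_step M0 M C T e"
      by (simp add: T_def)
    show ?case
    proof (cases "\<exists>i y. extends M0 M C i y e \<and> i \<inter> \<Union>T = {} \<and> card {s \<in> T. y \<in> s} < 2")
      case False
      then have "extend_step M0 M C T e = T" unfolding extend_step_def by (rule if_not_P)
      moreover have "T \<subseteq> set (es @ [e])" using sub by auto
      moreover have "i \<inter> \<Union>T \<noteq> {} \<or> 2 \<le> card {s \<in> T. y \<in> s}"
        if "f \<in> set (es @ [e])" "extends M0 M C i y f" for f i y
        using that maximal[of f i y] False by (cases "f = e") (auto simp: not_less)
      ultimately show ?thesis
        unfolding S using ext uniq load by simp
    next
      case True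
      then obtain i y where iy: "extends M0 M C i y e" "i \<inter> \<Union>T = {}" "card {s \<in> T. y \<in> s} < 2"
        by blast
      have S': "extend_step M0 M C T e = insert e T" using True unfolding extend_step_def by (rule if_P)
      obtain w where w: "w \<in> i" "i \<in> M0" "e = {w, y}" "y \<notin> \<Union>M0"
        using iy(1) unfolding extends_def by blast
      have only: "j = i" if "j \<in> M0" "e \<inter> j \<noteq> {}" for j
      proof -
        have "w \<in> j" using that w(3,4) by blast
        then show ?thesis using disjointD[OF assms(1) that(1) w(2)] w(1) by blast
      qed
      have "insert e T \<subseteq> set (es @ [e])" using sub by auto
      moreover have "\<exists>i y. extends M0 M C i y s" if "s \<in> insert e T" for s
        using that ext iy(1) by blast
      moreover have "s = t"
        if st: "s \<in> insert e T" "t \<in> insert e T" "j \<in> M0" "s \<inter> j \<noteq> {}" "t \<inter> j \<noteq> {}" for s t j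
      proof (rule ccontr)
        assume "s \<noteq> t"
        then consider "s = e" "t \<in> T" | "t = e" "s \<in> T" | "s \<in> T" "t \<in> T"
          using st(1,2) by blast
        then show False
        proof cases
          case 1
          then show ?thesis using only[OF st(3)] st(4,5) iy(2) by blast
        next
          case 2
          then show ?thesis using only[OF st(3)] st(4,5) iy(2) by blast
        next
          case 3
          then show ?thesis using uniq[OF _ _ st(3,4,5)] \<open>s \<noteq> t\<close> by blast
        qed
      qed
      moreover have "card {s \<in> insert e T. z \<in> s} \<le> 2" if z: "z \<notin> \<Union>M0" for z
      proof (cases "z \<in> e")
        case True
        then have "z = y" using w z by blast
        have "{s \<in> insert e T. z \<in> s} = insert e {s \<in> T. z \<in> s}" using True by blast
        then show ?thesis
          using iy(3) finT \<open>z = y\<close> by (simp add: card_insert_if)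
      next
        case False
        then have "{s \<in> insert e T. z \<in> s} = {s \<in> T. z \<in> s}" by blast
        then show ?thesis using load[OF z] by simp
      qed
      moreover have "j \<inter> \<Union>(insert e T) \<noteq> {} \<or> 2 \<le> card {s \<in> insert e T. z \<in> s}"
        if f: "f \<in> set (es @ [e])" "extends M0 M C j z f" for f j z
      proof (cases "f = e")
        case True
        have "e \<inter> j \<noteq> {}" using f(2) unfolding True extends_def by blast
        then show ?thesis by blast
      next
        case False
        then have "j \<inter> \<Union>T \<noteq> {} \<or> 2 \<le> card {s \<in> T. z \<in> s}"
          using maximal[OF _ f(2)] f(1) by simp
        moreover have "card {s \<in> T. z \<in> s} \<le> card {s \<in> insert e T. z \<in> s}"
          using finT by (intro card_mono) auto
        ultimately show ?thesis by auto
      qed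
      ultimately show ?thesis unfolding S S' by simp
    qed
  qed simp
  then show "S \<subseteq> set es" "\<And>s. s \<in> S \<Longrightarrow> \<exists>i y. extends M0 M C i y s"
    "\<And>s t i. \<lbrakk>s \<in> S; t \<in> S; i \<in> M0; s \<inter> i \<noteq> {}; t \<inter> i \<noteq> {}\<rbrakk> \<Longrightarrow> s = t"
    "\<And>y. y \<notin> \<Union>M0 \<Longrightarrow> card {s \<in> S. y \<in> s} \<le> 2"
    "\<And>e i y. \<lbrakk>e \<in> set es; extends M0 M C i y e\<rbrakk> \<Longrightarrow> i \<inter> \<Union>S \<noteq> {} \<or> 2 \<le> card {s \<in> S. y \<in> s}"
    by blast+
qed

lemma card_filter_eq_sum: "finite A \<Longrightarrow> card {i \<in> A. P i} = (\<Sum>i\<in>A. if P i then 1 else 0)"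
  by (simp add: sum.inter_filter[symmetric])

text \<open>Partners in a matching are unique; many of the injectivity arguments below reduce to
  this.\<close>

lemma disjoint_doubleton_eq:
  assumes "disjoint M" "{u, x} \<in> M" "{u', x} \<in> M"
  shows "u = u'"
proof -
  have "{u, x} = {u', x}" using disjointD[OF assms] by blast
  then show ?thesis by (auto simp: doubleton_eq_iff)
qed

section \<open>The approximation ratio\<close>

text \<open>What the passes guarantee once the order of the stream is forgotten. From here on the
  ratio is pure combinatorics of finite sets.\<close>

locale three_passes =
  fixes E M0 M C S :: "'v set set"
  assumes finite_E: "finite E" and card_edge: "\<And>e. e \<in> E \<Longrightarrow> card e = 2"
    and M0: "M0 \<subseteq> E" "disjoint M0" and M0_maximal: "\<And>e. e \<in> E \<Longrightarrow> e \<inter> \<Union>M0 \<noteq> {}"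
    and M: "M \<subseteq> E" "disjoint M" and M_wing: "\<And>e. e \<in> M \<Longrightarrow> wing (\<Union>M0) e"
    and M_maximal: "\<And>e. e \<in> E \<Longrightarrow> wing (\<Union>M0) e \<Longrightarrow> e \<inter> \<Union>M \<noteq> {}"
    and C: "C \<subseteq> E" and C_closes: "\<And>e. e \<in> C \<Longrightarrow> closes M0 M e"
    and C_complete: "\<And>u v x. \<lbrakk>{v, x} \<in> E; {u, v} \<in> M0; {u, x} \<in> M; x \<notin> \<Union>M0; v \<notin> \<Union>M\<rbrakk> \<Longrightarrow> {v, x} \<in> C"
    and S: "S \<subseteq> E" and S_extends: "\<And>s. s \<in> S \<Longrightarrow> \<exists>i y. extends M0 M C i y s"
    and S_unique: "\<And>s t i. \<lbrakk>s \<in> S; t \<in> S; i \<in> M0; s \<inter> i \<noteq> {}; t \<inter> i \<noteq> {}\<rbrakk> \<Longrightarrow> s = t"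
    and S_load: "\<And>y. y \<notin> \<Union>M0 \<Longrightarrow> card {s \<in> S. y \<in> s} \<le> 2"
    and S_maximal: "\<And>e i y. \<lbrakk>e \<in> E; extends M0 M C i y e\<rbrakk> \<Longrightarrow> i \<inter> \<Union>S \<noteq> {} \<or> 2 \<le> card {s \<in> S. y \<in> s}"
begin

lemma finite_stored: "finite M0" "finite M" "finite C" "finite S"
  using finite_E M0(1) M(1) C S by (auto intro: finite_subset)

lemma finite_edge: "e \<in> E \<Longrightarrow> finite e"
  using card_edge by (metis card.infinite zero_neq_numeral)

lemma finite_Union: "F \<subseteq> E \<Longrightarrow> finite (\<Union>F)"
  using finite_edge finite_E by (meson finite_Union finite_subset subsetD)

lemma M0_eqI: "i \<in> M0 \<Longrightarrow> j \<in> M0 \<Longrightarrow> w \<in> i \<Longrightarrow> w \<in> j \<Longrightarrow> i = j"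
  using disjointD[OF M0(2)] by blast

lemma M0_card: "i \<in> M0 \<Longrightarrow> card i = 2"
  using M0(1) card_edge by blast

section \<open>Two ways to augment \<open>M0\<close> by stored edges\<close>

lemma obtain_wing:
  assumes "p \<in> \<Union>M" "p \<in> \<Union>M0"
  obtains x where "{p, x} \<in> M" "x \<notin> \<Union>M0"
proof -
  obtain e where e: "e \<in> M" "p \<in> e" using assms(1) by blast
  obtain u x where ux: "e = {u, x}" "u \<in> \<Union>M0" "x \<notin> \<Union>M0"
    using M_wing[OF e(1)] unfolding wing_def by blast
  then have "p = u" using e(2) assms(2) by blast
  then show ?thesis using that ux e(1) by blast
qed

text \<open>An edge of \<open>M0\<close> with both ends covered by \<open>M\<close> is the middle of
  a path with two outer edges in \<open>M\<close>. These paths are disjoint because \<open>M\<close>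
  and \<open>M0\<close> are matchings.\<close>

lemma augment_wings:
  "\<exists>N. matching (M0 \<union> M \<union> C \<union> S) N \<and> card N = card M0 + card {i \<in> M0. i \<subseteq> \<Union>M}"
proof -
  define D where "D = {i \<in> M0. i \<subseteq> \<Union>M}"
  have "\<exists>u v a b. i = {u, v} \<and> u \<noteq> v \<and> a \<notin> \<Union>M0 \<and> b \<notin> \<Union>M0 \<and> {u, a} \<in> M \<and> {v, b} \<in> M"
    if "i \<in> D" for i
  proof -
    have i: "i \<in> M0" "i \<subseteq> \<Union>M" using that by (auto simp: D_def)
    obtain u v where uv: "i = {u, v}" "u \<noteq> v" using M0_card[OF i(1)] by (auto simp: card_2_iff)
    obtain a where a: "{u, a} \<in> M" "a \<notin> \<Union>M0" using obtain_wing[of u] i uv by blast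
    obtain b where b: "{v, b} \<in> M" "b \<notin> \<Union>M0" using obtain_wing[of v] i uv by blast
    show ?thesis using uv a b by blast
  qed
  then obtain u v a b where p: "\<And>i. i \<in> D \<Longrightarrow> i = {u i, v i} \<and> u i \<noteq> v i \<and> a i \<notin> \<Union>M0 \<and> b i \<notin> \<Union>M0
    \<and> {u i, a i} \<in> M \<and> {v i, b i} \<in> M"
    by metis
  have DM0: "i \<in> M0" if "i \<in> D" for i using that by (simp add: D_def)
  \<comment> \<open>An outer vertex has one \<open>M\<close>-partner, and that partner lies on one
    edge of \<open>M0\<close>.\<close>
  have owner: "i = j"
    if "i \<in> D" "j \<in> D" "{p, x} \<in> M" "{q, x} \<in> M" "p \<in> i" "q \<in> j" for i j p q x
    using disjoint_doubleton_eq[OF M(2) that(3,4)] M0_eqI[of i j p] that DM0 by blast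
  have "\<exists>N. matching (M0 \<union> M \<union> C \<union> S) N \<and> finite N \<and> card N = card M0 + card D
    \<and> \<Union>N = \<Union>M0 \<union> (\<Union>i\<in>D. {a i, b i}) \<and> M0 - (\<lambda>i. {u i, v i}) ` D \<subseteq> N"
  proof (rule matching_augment_paths)
    show "finite D" using finite_stored(1) by (simp add: D_def)
    fix i assume i: "i \<in> D"
    have "a i \<noteq> b i"
      using disjoint_doubleton_eq[OF M(2), of "u i" "a i" "v i"] p[OF i] by auto
    then show "{u i, v i} \<in> M0 \<and> u i \<noteq> v i \<and> a i \<notin> \<Union>M0 \<and> b i \<notin> \<Union>M0 \<and> a i \<noteq> b i
      \<and> {a i, u i} \<in> M0 \<union> M \<union> C \<union> S \<and> {v i, b i} \<in> M0 \<union> M \<union> C \<union> S"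
      using p[OF i] DM0[OF i] by (auto simp: insert_commute)
  next
    fix i j assume ij: "i \<in> D" "j \<in> D" "i \<noteq> j"
    have mem: "u i \<in> i" "v i \<in> i" "u j \<in> j" "v j \<in> j" using p[OF ij(1)] p[OF ij(2)] by blast+
    have "a i \<noteq> a j" "a i \<noteq> b j" "b i \<noteq> a j" "b i \<noteq> b j"
      using owner[OF ij(1,2)] p[OF ij(1)] p[OF ij(2)] mem ij(3) by metis+
    then show "{u i, v i} \<noteq> {u j, v j} \<and> {a i, b i} \<inter> {a j, b j} = {}"
      using p[OF ij(1)] p[OF ij(2)] ij(3) by auto
  qed (use M0(2) finite_stored(1) in auto)
  then show ?thesis unfolding D_def by blast
qed

text \<open>Each \<open>s\<close> in \<open>S\<close> completes a path \<open>x - w' - w - y\<close>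
  around its own edge of \<open>M0\<close>. The outer ends \<open>x\<close> are distinct and each
  \<open>y\<close> occurs at most twice, so \<open>disjoint_pairs_third\<close> selects a third of
  the paths with disjoint ends.\<close>

lemma augment_extensions:
  "\<exists>N. matching (M0 \<union> M \<union> C \<union> S) N \<and> 3 * card M0 + card S \<le> 3 * card N"
proof -
  have "\<exists>w w' x y. {w, w'} \<in> M0 \<and> w \<noteq> w' \<and> s = {w, y} \<and> {w', x} \<in> M \<union> C \<and> x \<noteq> y
    \<and> x \<notin> \<Union>M0 \<and> y \<notin> \<Union>M0" if "s \<in> S" for s
    using S_extends[OF that] unfolding extends_def by blast
  then obtain w w' x y where "\<And>s. s \<in> S \<Longrightarrow> {w s, w' s} \<in> M0 \<and> w s \<noteq> w' s
    \<and> s = {w s, y s} \<and> {w' s, x s} \<in> M \<union> C \<and> x s \<noteq> y s \<and> x s \<notin> \<Union>M0 \<and> y s \<notin> \<Union>M0"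
    by metis
  then have p: "{w s, w' s} \<in> M0" "w s \<noteq> w' s" "{w' s, x s} \<in> M \<union> C" "x s \<noteq> y s"
    "x s \<notin> \<Union>M0" "y s \<notin> \<Union>M0" "{w s, y s} = s" if "s \<in> S" for s
    using that by (blast, blast, blast, blast, blast, blast, metis)
  have mem: "w s \<in> s" "y s \<in> s" if "s \<in> S" for s using p(7)[OF that] by blast+
  have uM0: "w' s \<in> \<Union>M0" if "s \<in> S" for s using p(1)[OF that] by blast
  have inj: "s = t" if "s \<in> S" "t \<in> S" "{w s, w' s} = {w t, w' t}" for s t
  proof (rule S_unique[OF that(1,2) p(1)[OF that(1)]])
    show "s \<inter> {w s, w' s} \<noteq> {}" using mem(1)[OF that(1)] by blast
    show "t \<inter> {w s, w' s} \<noteq> {}" unfolding that(3) using mem(1)[OF that(2)] by blast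
  qed
  \<comment> \<open>Even if the stored side \<open>{w' s, x s}\<close> is only a closing edge, its
    triangle supplies an \<open>M\<close>-edge from \<open>x s\<close> to an end of the same
    \<open>M0\<close>-edge. So \<open>x s\<close> determines that \<open>M0\<close>-edge, and
    thereby \<open>s\<close>.\<close>
  have owner: "\<exists>u\<in>{w s, w' s}. {u, x s} \<in> M" if s: "s \<in> S" for s
  proof (cases "{w' s, x s} \<in> M")
    case False
    then have "{w' s, x s} \<in> C" using p(3)[OF s] by simp
    then have "closes M0 M {w' s, x s}" by (rule C_closes)
    then obtain u v z where uvz: "{w' s, x s} = {v, z}" "{u, v} \<in> M0" "{u, z} \<in> M" "z \<notin> \<Union>M0"
      unfolding closes_def by blast
    have "v \<in> \<Union>M0" using uvz(2) by blast
    then have "v \<noteq> x s" using p(5)[OF s] by metis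
    then have eq: "v = w' s" "z = x s" using uvz(1) by (simp_all add: doubleton_eq_iff)
    have "{u, v} = {w s, w' s}" by (rule M0_eqI[OF uvz(2) p(1)[OF s], of v]) (simp_all add: eq)
    then show ?thesis using uvz(3) eq(2) by (intro bexI[of _ u]) auto
  qed blast
  have "\<exists>D\<subseteq>S. card S \<le> 3 * card D \<and> (\<forall>s\<in>D. \<forall>t\<in>D. s \<noteq> t \<longrightarrow> {x s, y s} \<inter> {x t, y t} = {})"
  proof (rule disjoint_pairs_third)
    show "finite S" by (rule finite_stored)
    show "inj_on x S"
    proof (rule inj_onI)
      fix s t assume st: "s \<in> S" "t \<in> S" "x s = x t"
      obtain u where u: "u \<in> {w s, w' s}" "{u, x s} \<in> M" using owner[OF st(1)] by (elim bexE)
      obtain v where v: "v \<in> {w t, w' t}" "{v, x t} \<in> M" using owner[OF st(2)] by (elim bexE)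
      have "u = v" using disjoint_doubleton_eq[OF M(2) u(2)] v(2) st(3) by simp
      then have "{w s, w' s} = {w t, w' t}"
        using M0_eqI[OF p(1)[OF st(1)] p(1)[OF st(2)] u(1)] v(1) by simp
      then show "s = t" by (rule inj[OF st(1,2)])
    qed
    show "x s \<noteq> y s" if "s \<in> S" for s by (rule p(4)[OF that])
    show "card {s \<in> S. y s = z} \<le> 2" for z
    proof (cases "z \<in> \<Union>M0")
      case True
      then have "{s \<in> S. y s = z} = {}" using p(6) by blast
      then show ?thesis by (simp only: card.empty)
    next
      case False
      have "{s \<in> S. y s = z} \<subseteq> {s \<in> S. z \<in> s}" using mem(2) by blast
      then have "card {s \<in> S. y s = z} \<le> card {s \<in> S. z \<in> s}"
        using finite_stored(4) by (intro card_mono) auto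
      then show ?thesis using S_load[OF False] by simp
    qed
  qed
  then obtain D where D: "D \<subseteq> S" "card S \<le> 3 * card D"
    "\<forall>s\<in>D. \<forall>t\<in>D. s \<noteq> t \<longrightarrow> {x s, y s} \<inter> {x t, y t} = {}" by (elim exE conjE)
  have "\<exists>N. matching (M0 \<union> M \<union> C \<union> S) N \<and> finite N \<and> card N = card M0 + card D
    \<and> \<Union>N = \<Union>M0 \<union> (\<Union>s\<in>D. {y s, x s}) \<and> M0 - (\<lambda>s. {w s, w' s}) ` D \<subseteq> N"
  proof (rule matching_augment_paths)
    show "finite D" using D(1) finite_stored(4) by (rule finite_subset)
    fix s assume "s \<in> D"
    then have s: "s \<in> S" using D(1) by blast
    have "{y s, w s} = s" using p(7)[OF s] by (simp add: insert_commute)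
    then have "{y s, w s} \<in> M0 \<union> M \<union> C \<union> S" using s by simp
    moreover have "{w' s, x s} \<in> M0 \<union> M \<union> C \<union> S" using p(3)[OF s] by blast
    ultimately show "{w s, w' s} \<in> M0 \<and> w s \<noteq> w' s \<and> y s \<notin> \<Union>M0 \<and> x s \<notin> \<Union>M0 \<and> y s \<noteq> x s
      \<and> {y s, w s} \<in> M0 \<union> M \<union> C \<union> S \<and> {w' s, x s} \<in> M0 \<union> M \<union> C \<union> S"
      by (intro conjI p(1,2,5,6)[OF s] not_sym[OF p(4)[OF s]])
  next
    fix s t assume st: "s \<in> D" "t \<in> D" "s \<noteq> t"
    then have sS: "s \<in> S" "t \<in> S" using D(1) by blast+
    have "{w s, w' s} \<noteq> {w t, w' t}" using inj[OF sS] st(3) by (rule contrapos_nn[rotated])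
    moreover have "{y s, x s} \<inter> {y t, x t} = {}"
      using D(3) st by (simp add: insert_commute)
    ultimately show "{w s, w' s} \<noteq> {w t, w' t} \<and> {y s, x s} \<inter> {y t, x t} = {}" by (rule conjI)
  qed (use M0(2) finite_stored(1) in auto)
  then obtain N where "matching (M0 \<union> M \<union> C \<union> S) N" "card N = card M0 + card D" by (elim exE conjE)
  then show ?thesis using D(2) by (intro exI[of _ N]) simp
qed

section \<open>Comparison with a fixed matching \<open>Opt\<close> of the graph\<close>

context
  fixes Opt
  assumes Opt: "matching E Opt"
begin

text \<open>A set of inner vertices, unlike the edge predicate \<open>wing\<close>: the vertices of
  \<open>\<Union>M0\<close> that \<open>Opt\<close> matches outside.\<close>

definition "wings = {w \<in> \<Union>M0. \<exists>y. y \<notin> \<Union>M0 \<and> {w, y} \<in> Opt}"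

definition "good = {i \<in> M0. i \<subseteq> wings}"

definition "covered = \<Union>M0 \<inter> \<Union>M"

lemma Opt_facts: "Opt \<subseteq> E" "disjoint Opt" "finite Opt"
  using Opt finite_E by (auto simp: matching_iff_disjoint intro: finite_subset)

lemma finite_sets: "finite (\<Union>M0)" "finite wings" "finite covered" "finite good"
proof -
  show fin: "finite (\<Union>M0)" by (rule finite_Union[OF M0(1)])
  show "finite wings" by (rule finite_subset[OF _ fin]) (auto simp: wings_def)
  show "finite covered" using fin by (simp add: covered_def)
  show "finite good" using finite_stored(1) by (simp add: good_def)
qed

text \<open>Count each \<open>Opt\<close>-edge by its ends in \<open>\<Union>M0\<close> plus its
  ends in \<open>wings\<close>. The count is at least 2: either both ends are inner, or by
  maximality exactly one is, and that one is in \<open>wings\<close>. The total is at most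
  \<open>2 * card M0 + card wings\<close>, and an \<open>M0\<close>-edge that is not good has at
  most one end in \<open>wings\<close>.\<close>

lemma card_good: "2 * card Opt \<le> 3 * card M0 + card good"
proof -
  have "2 \<le> card (\<Union>M0 \<inter> e) + card (wings \<inter> e)" if "e \<in> Opt" for e
  proof (cases "e \<subseteq> \<Union>M0")
    case True
    then have "\<Union>M0 \<inter> e = e" by blast
    then show ?thesis using card_edge Opt_facts(1) that by auto
  next
    case False
    have eE: "e \<in> E" using that Opt_facts(1) by blast
    obtain u where u: "u \<in> e" "u \<in> \<Union>M0" using M0_maximal[OF eE] by blast
    obtain x where x: "x \<in> e" "x \<notin> \<Union>M0" using False by blast
    have "e = {u, x}" using card_edge[OF eE] u x by (auto simp: card_2_iff)
    then have "u \<in> wings" using u x that by (auto simp: wings_def)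
    then have "0 < card (\<Union>M0 \<inter> e)" "0 < card (wings \<inter> e)"
      using u finite_sets by (auto simp: card_gt_0_iff)
    then show ?thesis by linarith
  qed
  then have "(\<Sum>e\<in>Opt. 2) \<le> (\<Sum>e\<in>Opt. card (\<Union>M0 \<inter> e) + card (wings \<inter> e))" by (rule sum_mono)
  also have "\<dots> = card (\<Union>M0 \<inter> \<Union>Opt) + card (wings \<inter> \<Union>Opt)"
    by (simp only: sum.distrib card_Int_Union_disjoint[OF Opt_facts(3,2)] finite_sets)
  also have "\<dots> \<le> card (\<Union>M0) + card wings"
    using finite_sets by (intro add_mono card_mono) auto
  also have "card (\<Union>M0) = (\<Sum>i\<in>M0. card i)"
    using M0 finite_edge by (intro card_Union_disjoint) auto
  also have "\<dots> = 2 * card M0" using M0_card by simp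
  also have "wings = wings \<inter> \<Union>M0" by (auto simp: wings_def)
  also have "card \<dots> = (\<Sum>i\<in>M0. card (wings \<inter> i))"
    by (rule card_Int_Union_disjoint[OF finite_stored(1) M0(2) finite_sets(2)])
  also have "\<dots> \<le> (\<Sum>i\<in>M0. 1 + (if i \<subseteq> wings then 1 else 0))"
  proof (rule sum_mono)
    fix i assume i: "i \<in> M0"
    show "card (wings \<inter> i) \<le> 1 + (if i \<subseteq> wings then 1 else 0)"
    proof (cases "i \<subseteq> wings")
      case True
      then show ?thesis using M0_card[OF i] card_mono[of i "wings \<inter> i"] finite_edge M0(1) i by auto
    next
      case False
      then have "wings \<inter> i \<subset> i" by blast
      then have "card (wings \<inter> i) < card i"
        using finite_edge M0(1) i by (intro psubset_card_mono) auto
      then show ?thesis using M0_card[OF i] by simp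
    qed
  qed
  also have "\<dots> = card M0 + card good"
    by (simp only: sum.distrib good_def card_filter_eq_sum[OF finite_stored(1)]) simp
  finally show ?thesis by simp
qed

text \<open>\<open>Opt\<close> joins an uncovered end of a good edge to an outer vertex, which the
  greedy \<open>M\<close> must therefore cover. These outer vertices are distinct, and
  \<open>M\<close> has as many outer ends as inner ones.\<close>

lemma card_covered_le: "card (\<Union>good - covered) \<le> card covered"
proof -
  have fM: "finite (\<Union>M)" by (rule finite_Union[OF M(1)])
  have one: "card (\<Union>M0 \<inter> e) = 1" "card ((- \<Union>M0) \<inter> e) = 1" if e: "e \<in> M" for e
  proof -
    obtain u x where ux: "e = {u, x}" "u \<in> \<Union>M0" "x \<notin> \<Union>M0"
      using M_wing[OF e] unfolding wing_def by blast
    have "\<Union>M0 \<inter> e = {u}" "(- \<Union>M0) \<inter> e = {x}" using ux by blast+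
    then show "card (\<Union>M0 \<inter> e) = 1" "card ((- \<Union>M0) \<inter> e) = 1" by simp_all
  qed
  have cov: "card covered = card M"
    unfolding covered_def using one(1)
    by (simp add: card_Int_Union_disjoint[OF finite_stored(2) M(2) finite_sets(1)])
  have "\<Union>M - \<Union>M0 = (\<Union>e\<in>M. (- \<Union>M0) \<inter> e)" by blast
  also have "card \<dots> = (\<Sum>e\<in>M. card ((- \<Union>M0) \<inter> e))"
    using finite_stored(2) M finite_edge by (intro card_UN_disjoint) (auto dest: disjointD)
  finally have out: "card (\<Union>M - \<Union>M0) = card M" using one(2) by simp
  have "\<exists>y. {w, y} \<in> Opt \<and> y \<in> \<Union>M - \<Union>M0" if "w \<in> \<Union>good - covered" for w
  proof -
    have w: "w \<in> wings" "w \<in> \<Union>M0" "w \<notin> \<Union>M"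
      using that by (auto simp: good_def covered_def)
    obtain y where y: "y \<notin> \<Union>M0" "{w, y} \<in> Opt" using w(1) by (auto simp: wings_def)
    have "{w, y} \<in> E" "wing (\<Union>M0) {w, y}" using y w(2) Opt_facts(1) unfolding wing_def by blast+
    then show ?thesis using M_maximal w(3) y by blast
  qed
  then obtain f where f: "\<And>w. w \<in> \<Union>good - covered \<Longrightarrow> {w, f w} \<in> Opt \<and> f w \<in> \<Union>M - \<Union>M0"
    by metis
  have "inj_on f (\<Union>good - covered)"
    by (rule inj_onI) (metis f disjoint_doubleton_eq[OF Opt_facts(2)])
  then have "card (\<Union>good - covered) \<le> card (\<Union>M - \<Union>M0)"
    by (rule card_inj_on_le) (use f fM in blast)+
  then show ?thesis using cov out by simp
qed

text \<open>An inequality for each edge of \<open>M0\<close>, checked for 0, 1 and 2 covered ends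
  and tight on all good edges. After summation \<open>card_covered_le\<close> lets the uncovered
  ends of good edges cancel against \<open>card covered\<close>.\<close>

lemma card_good_half_covered:
  "3 * card good \<le> card M0 + 2 * card {i \<in> good. card (covered \<inter> i) = 1} + 4 * card {i \<in> M0. i \<subseteq> \<Union>M}"
proof -
  define c where "c i = card (covered \<inter> i)" for i
  have good: "good \<subseteq> M0" by (auto simp: good_def)
  have c2: "c i \<le> 2" "c i = 2 \<longleftrightarrow> i \<subseteq> \<Union>M" "card (i - covered) = 2 - c i" if i: "i \<in> M0" for i
  proof -
    have fi: "finite i" "card i = 2" using i M0(1) finite_edge M0_card by auto
    show "c i \<le> 2" using card_mono[OF fi(1), of "covered \<inter> i"] fi(2) by (simp add: c_def)
    have "c i = 2 \<longleftrightarrow> covered \<inter> i = i"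
      using card_subset_eq[OF fi(1), of "covered \<inter> i"] fi(2) by (auto simp: c_def)
    also have "\<dots> \<longleftrightarrow> i \<subseteq> \<Union>M" using i by (auto simp: covered_def)
    finally show "c i = 2 \<longleftrightarrow> i \<subseteq> \<Union>M" .
    show "card (i - covered) = 2 - c i"
      using card_Diff_subset_Int[of i covered] fi by (simp add: c_def Int_commute)
  qed
  have "\<Union>good - covered = (\<Union>i\<in>good. i - covered)" by blast
  also have "card \<dots> = (\<Sum>i\<in>good. card (i - covered))"
  proof (rule card_UN_disjoint)
    show "finite good" by (rule finite_sets)
    show "\<forall>i\<in>good. finite (i - covered)" using good M0(1) finite_edge by (meson finite_Diff subsetD)
    show "\<forall>i\<in>good. \<forall>j\<in>good. i \<noteq> j \<longrightarrow> (i - covered) \<inter> (j - covered) = {}"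
      using good disjointD[OF M0(2)] by blast
  qed
  also have "\<dots> = (\<Sum>i\<in>good. 2 - c i)" using c2(3) good by (intro sum.cong) auto
  also have "\<dots> = (\<Sum>i\<in>M0. if i \<in> good then 2 - c i else 0)"
    using good finite_stored(1) by (simp add: sum.inter_restrict[symmetric] Int_absorb1)
  finally have uncov: "card (\<Union>good - covered) = (\<Sum>i\<in>M0. if i \<in> good then 2 - c i else 0)" .
  have "covered = covered \<inter> \<Union>M0" by (auto simp: covered_def)
  then have cov: "card covered = (\<Sum>i\<in>M0. c i)"
    unfolding c_def using card_Int_Union_disjoint[OF finite_stored(1) M0(2) finite_sets(3)] by simp
  have "good = {i \<in> M0. i \<in> good}" using good by blast
  then have k: "card good = (\<Sum>i\<in>M0. if i \<in> good then 1 else 0)"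
    using card_filter_eq_sum[OF finite_stored(1), of "\<lambda>i. i \<in> good"] by simp
  have "{i \<in> good. card (covered \<inter> i) = 1} = {i \<in> M0. i \<in> good \<and> c i = 1}"
    using good by (auto simp: c_def)
  then have g1: "card {i \<in> good. card (covered \<inter> i) = 1} = (\<Sum>i\<in>M0. if i \<in> good \<and> c i = 1 then 1 else 0)"
    by (simp only: card_filter_eq_sum[OF finite_stored(1)])
  have d2: "card {i \<in> M0. i \<subseteq> \<Union>M} = (\<Sum>i\<in>M0. if c i = 2 then 1 else 0)"
    unfolding card_filter_eq_sum[OF finite_stored(1)] using c2(2) by (intro sum.cong) auto
  have "3 * card good + card covered = (\<Sum>i\<in>M0. 3 * (if i \<in> good then 1 else 0) + c i)"
    unfolding k cov by (simp only: sum.distrib sum_distrib_left)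
  also have "\<dots> \<le> (\<Sum>i\<in>M0. 1 + 2 * (if i \<in> good \<and> c i = 1 then 1 else 0) + 4 * (if c i = 2 then 1 else 0)
      + (if i \<in> good then 2 - c i else 0))"
  proof (rule sum_mono)
    fix i assume "i \<in> M0"
    then have "c i = 0 \<or> c i = 1 \<or> c i = 2" using c2(1)[of i] by linarith
    then show "3 * (if i \<in> good then 1 else 0) + c i \<le> 1 + 2 * (if i \<in> good \<and> c i = 1 then 1 else 0)
      + 4 * (if c i = 2 then 1 else 0) + (if i \<in> good then 2 - c i else 0)"
      by auto
  qed
  also have "\<dots> = card M0 + 2 * card {i \<in> good. card (covered \<inter> i) = 1} + 4 * card {i \<in> M0. i \<subseteq> \<Union>M}
      + card (\<Union>good - covered)"
    unfolding g1 d2 uncov by (simp only: sum.distrib sum_distrib_left) simp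
  finally show ?thesis using card_covered_le by linarith
qed

text \<open>Let \<open>p\<close> be the covered end, \<open>x\<close> its \<open>M\<close>-partner,
  and \<open>a\<close>, \<open>b\<close> the \<open>Opt\<close>-partners of \<open>p\<close> and
  \<open>q\<close>. Normally \<open>x - p - q - b\<close> is the path; it degenerates to a triangle
  exactly when \<open>b = x\<close>.\<close>

lemma good_half_covered_extension:
  assumes "i \<in> good" "card (covered \<inter> i) = 1"
  obtains w z where "w \<in> i" "{w, z} \<in> Opt" "z \<notin> \<Union>M0" "extends M0 M C i z {w, z}"
proof -
  have i: "i \<in> M0" "i \<subseteq> wings" using assms(1) by (auto simp: good_def)
  obtain p where p: "covered \<inter> i = {p}" using assms(2) by (auto simp: card_1_singleton_iff)
  then have "p \<in> i" by blast
  then obtain q where q: "i = {p, q}" "p \<noteq> q" using M0_card[OF i(1)] by (auto simp: card_2_iff)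
  have pc: "p \<in> \<Union>M" "p \<in> \<Union>M0" using p by (auto simp: covered_def)
  have qM: "q \<notin> \<Union>M" using p q i(1) by (auto simp: covered_def)
  obtain x where x: "{p, x} \<in> M" "x \<notin> \<Union>M0" using obtain_wing[OF pc] .
  obtain a where a: "a \<notin> \<Union>M0" "{p, a} \<in> Opt" using i(2) q by (auto simp: wings_def)
  obtain b where b: "b \<notin> \<Union>M0" "{q, b} \<in> Opt" using i(2) q by (auto simp: wings_def)
  show ?thesis
  proof (cases "b = x")
    case False
    have "extends M0 M C i b {q, b}"
      unfolding extends_def using i(1) q qM x b False by blast
    then show ?thesis using that[of q b] b q by blast
  next
    \<comment> \<open>In a triangle \<open>{q, x}\<close> was stored in \<open>C\<close>, so the
      path turns around to \<open>x - q - p - a\<close>. Here \<open>a\<close> differs from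
      \<open>x\<close> because \<open>Opt\<close> already matches \<open>x\<close> to
      \<open>q\<close>.\<close>
    case True
    have "a \<noteq> x" using disjoint_doubleton_eq[OF Opt_facts(2) a(2)] b(2) True q(2) by blast
    have "{p, q} \<in> M0" using i(1) q(1) by simp
    moreover have "{q, x} \<in> E" using b(2) True Opt_facts(1) by blast
    ultimately have "{q, x} \<in> C" using C_complete x qM by blast
    then have "extends M0 M C i a {p, a}"
      unfolding extends_def using i(1) q qM x a \<open>a \<noteq> x\<close> by blast
    then show ?thesis using that[of p a] a q by blast
  qed
qed

text \<open>Edges touched by \<open>S\<close> number at most \<open>card S\<close>, as each edge of
  \<open>S\<close> touches only one. An untouched edge had its \<open>Opt\<close>-extension refused,
  so its outer \<open>Opt\<close>-partner carries two edges of \<open>S\<close>. These partners are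
  distinct and an edge of \<open>S\<close> has one outer end, so at most \<open>card S / 2\<close>
  edges are untouched.\<close>

lemma card_half_covered: "2 * card {i \<in> good. card (covered \<inter> i) = 1} \<le> 3 * card S"
proof -
  define H where "H = {i \<in> good. card (covered \<inter> i) = 1}"
  define A where "A = {i \<in> H. i \<inter> \<Union>S \<noteq> {}}"
  define B where "B = {i \<in> H. i \<inter> \<Union>S = {}}"
  have finH: "finite H" using finite_sets(4) by (simp add: H_def)
  have HM0: "i \<in> M0" if "i \<in> H" for i using that by (simp add: H_def good_def)
  have shape: "\<exists>w y. s = {w, y} \<and> w \<in> \<Union>M0 \<and> y \<notin> \<Union>M0" if "s \<in> S" for s
    using S_extends[OF that] unfolding extends_def by blast
  have "\<exists>s. s \<in> S \<and> i \<inter> s \<noteq> {}" if "i \<in> A" for i using that by (auto simp: A_def)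
  then obtain f where f: "\<And>i. i \<in> A \<Longrightarrow> f i \<in> S \<and> i \<inter> f i \<noteq> {}" by metis
  have "inj_on f A"
  proof (rule inj_onI)
    fix i j assume ij: "i \<in> A" "j \<in> A" "f i = f j"
    have M0: "i \<in> M0" "j \<in> M0" using ij HM0 by (auto simp: A_def)
    have "f i \<in> S" using f[OF ij(1)] by simp
    from shape[OF this] obtain w y where wy: "f i = {w, y}" "y \<notin> \<Union>M0" by (elim exE conjE)
    have "i \<inter> {w, y} \<noteq> {}" "j \<inter> {w, y} \<noteq> {}"
      using f[OF ij(1)] f[OF ij(2)] unfolding ij(3)[symmetric] wy(1) by simp_all
    moreover have "y \<notin> i" "y \<notin> j" using wy(2) M0 by blast+
    ultimately have "w \<in> i" "w \<in> j" by simp_all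
    then show "i = j" by (rule M0_eqI[OF M0])
  qed
  then have A: "card A \<le> card S"
    by (rule card_inj_on_le) (use f finite_stored(4) in auto)
  define heavy where "heavy z \<longleftrightarrow> 2 \<le> card {s \<in> S. z \<in> s}" for z
  have "\<exists>w z. w \<in> i \<and> {w, z} \<in> Opt \<and> z \<notin> \<Union>M0 \<and> heavy z" if iB: "i \<in> B" for i
  proof -
    have i: "i \<in> good" "card (covered \<inter> i) = 1" "i \<inter> \<Union>S = {}"
      using iB by (auto simp: B_def H_def)
    obtain w z where wz: "w \<in> i" "{w, z} \<in> Opt" "z \<notin> \<Union>M0" "extends M0 M C i z {w, z}"
      using good_half_covered_extension[OF i(1,2)] .
    have "{w, z} \<in> E" using wz(2) Opt_facts(1) by blast
    from S_maximal[OF this wz(4)] i(3) have "heavy z" by (simp add: heavy_def)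
    then show ?thesis using wz(1,2,3) by (intro exI conjI)
  qed
  then obtain w z where wz: "\<And>i. i \<in> B \<Longrightarrow> w i \<in> i \<and> {w i, z i} \<in> Opt \<and> z i \<notin> \<Union>M0 \<and> heavy (z i)"
    by metis
  have zne: "z i \<noteq> z j" if ij: "i \<in> B" "j \<in> B" "i \<noteq> j" for i j
  proof
    assume "z i = z j"
    then have "w i = w j"
      using disjoint_doubleton_eq[OF Opt_facts(2)] wz[OF ij(1)] wz[OF ij(2)] by metis
    moreover have "i \<in> M0" "j \<in> M0" using ij(1,2) HM0 by (simp_all add: B_def)
    ultimately show False using M0_eqI[of i j "w i"] wz[OF ij(1)] wz[OF ij(2)] ij(3) by simp
  qed
  have "2 * card B = (\<Sum>i\<in>B. 2)" by simp
  also have "\<dots> \<le> (\<Sum>i\<in>B. card {s \<in> S. z i \<in> s})" 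
    using wz by (intro sum_mono) (simp add: heavy_def)
  also have "\<dots> = card (\<Union>i\<in>B. {s \<in> S. z i \<in> s})"
  proof (rule card_UN_disjoint[symmetric])
    show "finite B" using finH by (simp add: B_def)
    show "\<forall>i\<in>B. finite {s \<in> S. z i \<in> s}" using finite_stored(4) by simp
    show "\<forall>i\<in>B. \<forall>j\<in>B. i \<noteq> j \<longrightarrow> {s \<in> S. z i \<in> s} \<inter> {s \<in> S. z j \<in> s} = {}"
    proof (intro ballI impI)
      fix i j assume ij: "i \<in> B" "j \<in> B" "i \<noteq> j"
      have out: "z i \<notin> \<Union>M0" "z j \<notin> \<Union>M0" using wz[OF ij(1)] wz[OF ij(2)] by simp_all
      have "z i \<notin> s \<or> z j \<notin> s" if "s \<in> S" for s
      proof -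
        obtain w' y where s: "s = {w', y}" "w' \<in> \<Union>M0" using shape[OF \<open>s \<in> S\<close>] by (elim exE conjE)
        then have "z i \<noteq> w'" "z j \<noteq> w'" using out by metis+
        then show ?thesis using s(1) zne[OF ij] by auto
      qed
      then show "{s \<in> S. z i \<in> s} \<inter> {s \<in> S. z j \<in> s} = {}" by blast
    qed
  qed
  also have "\<dots> \<le> card S" using finite_stored(4) by (intro card_mono) auto
  finally have B: "2 * card B \<le> card S" .
  have "card (A \<union> B) = card A + card B"
    using finH by (intro card_Un_disjoint) (auto simp: A_def B_def)
  moreover have "A \<union> B = H" by (auto simp: A_def B_def)
  ultimately have "card H = card A + card B" by simp
  then show ?thesis using A B by (simp add: H_def)
qed

end

text \<open>With \<open>r = card R\<close>, the two augmentations give \<open>d \<le> r - m\<close>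
  and \<open>|S| \<le> 3 r - 3 m\<close>. Then \<open>3 k \<le> m + 3 |S| + 4 d\<close> becomes
  \<open>13 r \<ge> 12 m + 3 k\<close>, which is at least \<open>6 o + 3 m\<close>. Finally
  \<open>k \<le> m\<close> and \<open>k \<ge> 2 o - 3 m\<close> force
  \<open>m \<ge> o / 2\<close>.\<close>

lemma ratio:
  assumes "matching E Opt" "maximum_matching (M0 \<union> M \<union> C \<union> S) R"
  shows "15 * card Opt \<le> 26 * card R"
proof -
  have max: "card N \<le> card R" if "matching (M0 \<union> M \<union> C \<union> S) N" for N
    using assms(2) that by (simp add: maximum_matching_def)
  have "card (good Opt) \<le> card M0"
    using finite_stored(1) by (intro card_mono) (auto simp: good_def[OF assms(1)])
  moreover have "card M0 + card {i \<in> M0. i \<subseteq> \<Union>M} \<le> card R" using augment_wings max by metis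
  moreover have "3 * card M0 + card S \<le> 3 * card R"
    using augment_extensions max by (meson le_trans mult_le_mono2)
  ultimately show ?thesis
    using card_good[OF assms(1)] card_good_half_covered[OF assms(1)] card_half_covered[OF assms(1)]
    by linarith
qed

end

section \<open>The streaming algorithm and its space\<close>

text \<open>The first component is the pass counter, which the model does not supply; then come
  \<open>M0\<close>, \<open>M\<close>, \<open>C\<close> and \<open>S\<close>.\<close>

type_synonym 'v memory = "nat \<times> 'v set set \<times> 'v set set \<times> 'v set set \<times> 'v set set"

fun pass_step :: "'v memory \<Rightarrow> 'v set \<Rightarrow> 'v memory" where
  "pass_step (p, M0, M, C, S) e =
     (if p = 0 then (p, greedy_step M0 e, M, C, S)
      else if p = 1 then (let (M', C') = wing_step M0 (M, C) e in (p, M0, M', C', S))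
      else (p, M0, M, C, extend_step M0 M C S e))"

fun next_pass :: "'v memory \<Rightarrow> 'v memory" where
  "next_pass (p, Q) = (Suc p, Q)"

fun best_matching :: "'v memory \<Rightarrow> 'v set set" where
  "best_matching (p, M0, M, C, S) = (SOME R. maximum_matching (M0 \<union> M \<union> C \<union> S) R)"

declare wing_step.simps [simp del]

lemma foldl_pass_step:
  "foldl pass_step (0, M0, M, C, S) es = (0, foldl greedy_step M0 es, M, C, S)"
  "foldl pass_step (Suc 0, M0, M, C, S) es =
     (let (M', C') = foldl (wing_step M0) (M, C) es in (Suc 0, M0, M', C', S))"
  "foldl pass_step (Suc (Suc p), M0, M, C, S) es = (Suc (Suc p), M0, M, C, foldl (extend_step M0 M C) S es)"
  by (induction es rule: rev_induct) (auto simp: split_beta Let_def)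

definition sparse_edge_sets :: "'v set \<Rightarrow> 'v set set set" where
  "sparse_edge_sets V = {X. X \<subseteq> (\<lambda>(u, v). {u, v}) ` (V \<times> V) \<and> card X \<le> card V}"

text \<open>Distinct representatives: an injective choice of an end for each edge bounds the number
  of edges by the number of vertices.\<close>

lemma sparse_edge_setsI:
  assumes "ugraph V E" "X \<subseteq> E" "inj_on f X" "\<And>e. e \<in> X \<Longrightarrow> f e \<in> e"
  shows "X \<in> sparse_edge_sets V"
proof -
  have E: "E \<subseteq> (\<lambda>(u, v). {u, v}) ` (V \<times> V)" "\<Union>E \<subseteq> V" "finite V"
    using assms(1) by (auto simp: ugraph_def)
  have "f ` X \<subseteq> V" using E(2) assms(2,4) by blast
  then have "card X \<le> card V" using assms(3) E(3) by (intro card_inj_on_le)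
  then show ?thesis using assms(2) E(1) by (auto simp: sparse_edge_sets_def)
qed

lemma card_sparse_edge_sets:
  assumes "finite V"
  shows "finite (sparse_edge_sets V)" "card (sparse_edge_sets V) \<le> (card V ^ 2 + 1) ^ card V"
proof -
  define P where "P = (\<lambda>(u, v). {u, v}) ` (V \<times> V)"
  define L where "L = {xs. set xs \<subseteq> insert {} P \<and> length xs = card V}"
  have "card P \<le> card (V \<times> V)" unfolding P_def using assms by (intro card_image_le) simp
  moreover have finP: "finite P" using assms by (simp add: P_def)
  ultimately have P: "card (insert {} P) \<le> card V ^ 2 + 1"
    by (simp add: card_insert_if card_cartesian_product power2_eq_square)
  have L: "finite L" "card L = card (insert {} P) ^ card V"
    unfolding L_def using finP by (intro finite_lists_length_eq card_lists_length_eq; simp)+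
  have sub: "sparse_edge_sets V \<subseteq> (\<lambda>xs. set xs - {{}}) ` L"
  proof
    fix X assume "X \<in> sparse_edge_sets V"
    then have X: "X \<subseteq> P" "card X \<le> card V" by (auto simp: sparse_edge_sets_def P_def)
    have "{} \<notin> X" using X(1) by (auto simp: P_def)
    obtain xs where xs: "set xs = X" "distinct xs"
      using finite_distinct_list finite_subset[OF X(1) finP] by blast
    have len: "length xs \<le> card V" using X(2) xs distinct_card[of xs] by simp
    \<comment> \<open>Lists of fixed length are easy to count, so shorter ones are padded with
      \<open>{}\<close>, which is no edge. This filler symbol is the 1 in
      \<open>card V ^ 2 + 1\<close>.\<close>
    define ys where "ys = xs @ replicate (card V - length xs) {}"
    have "ys \<in> L" using xs X(1) len by (auto simp: L_def ys_def)
    moreover have "X = set ys - {{}}" using xs \<open>{} \<notin> X\<close> by (auto simp: ys_def set_replicate_conv_if)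
    ultimately show "X \<in> (\<lambda>xs. set xs - {{}}) ` L" by blast
  qed
  show "finite (sparse_edge_sets V)" using sub L(1) by (meson finite_imageI finite_subset)
  have "card (sparse_edge_sets V) \<le> card L"
    using sub L(1) by (meson card_image_le card_mono finite_imageI le_trans)
  also have "\<dots> \<le> (card V ^ 2 + 1) ^ card V" unfolding L(2) using P by (rule power_mono) simp
  finally show "card (sparse_edge_sets V) \<le> (card V ^ 2 + 1) ^ card V" .
qed

text \<open>The counter takes four values, 3 being reached after the last pass; this accounts for
  the 2 in \<open>space\<close>.\<close>

definition memories :: "'v set \<Rightarrow> 'v memory set" where
  "memories V = {..3} \<times> sparse_edge_sets V \<times> sparse_edge_sets V \<times> sparse_edge_sets V \<times> sparse_edge_sets V"

definition edge_bits :: "nat \<Rightarrow> nat" where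
  "edge_bits n = nat \<lceil>log 2 (real n ^ 2 + 1)\<rceil>"

definition space :: "nat \<Rightarrow> nat" where
  "space n = 2 + 4 * (n * edge_bits n)"

lemma edge_bits: "n ^ 2 + 1 \<le> 2 ^ edge_bits n"
proof -
  have pos: "0 < real n ^ 2 + 1" by (simp add: add_nonneg_pos)
  have "log 2 (real n ^ 2 + 1) \<le> real (edge_bits n)"
    unfolding edge_bits_def by (rule real_nat_ceiling_ge)
  then have "real n ^ 2 + 1 \<le> 2 powr real (edge_bits n)"
    using pos by (simp add: log_le_iff)
  then have "real (n ^ 2 + 1) \<le> real (2 ^ edge_bits n)"
    by (simp add: powr_realpow)
  then show ?thesis by (simp only: of_nat_le_iff)
qed

lemma card_memories:
  assumes "finite V"
  shows "finite (memories V) \<and> card (memories V) \<le> 2 ^ space (card V)"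
proof
  let ?n = "card V" and ?k = "card (sparse_edge_sets V)"
  note fin = card_sparse_edge_sets(1)[OF assms]
  show "finite (memories V)" using fin by (simp add: memories_def)
  have "?k \<le> (?n ^ 2 + 1) ^ ?n" by (rule card_sparse_edge_sets(2)[OF assms])
  also have "\<dots> \<le> (2 ^ edge_bits ?n) ^ ?n" by (rule power_mono[OF edge_bits]) simp
  also have "\<dots> = 2 ^ (?n * edge_bits ?n)" by (simp add: power_mult[symmetric] mult.commute)
  finally have k: "?k \<le> 2 ^ (?n * edge_bits ?n)" .
  have "card (memories V) = 4 * ?k ^ 4"
    by (simp add: memories_def card_cartesian_product power4_eq_xxxx)
  also have "\<dots> \<le> 4 * (2 ^ (?n * edge_bits ?n)) ^ 4"
    using power_mono[OF k, of 4] by simp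
  also have "\<dots> = 2 ^ space ?n" by (simp add: space_def power_add power_mult[symmetric] mult.commute)
  finally show "card (memories V) \<le> 2 ^ space ?n" .
qed

lemma space_bigo: "(\<lambda>n. real (space n)) \<in> O(\<lambda>n. real n * ln (real n) powr 1)"
\<comment> \<open>With \<open>l\<close> the binary logarithm of \<open>n \<ge> 2\<close>,
  \<open>edge_bits n\<close> is at most \<open>3 l + 1 \<le> 4 l\<close>, the 1 coming from rounding
  up. So the space is at most \<open>2 + 16 n l \<le> 18 n l\<close>.\<close>
proof (rule bigoI[where c = "18 / ln 2"])
  have "real (space n) \<le> 18 / ln 2 * (real n * ln (real n))" if n: "2 \<le> n" for n
  proof -
    define l where "l = ln (real n) / ln 2"
    have l: "1 \<le> l" using n by (simp add: l_def le_divide_eq)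
    have "real n ^ 2 + 1 \<le> 2 * real n ^ 2" using n by (simp add: power2_eq_square mult_le_one mult_ge1_I)
    also have "\<dots> \<le> real n * real n ^ 2" using n by (intro mult_right_mono) auto
    finally have "real n ^ 2 + 1 \<le> real n ^ 3" by (simp add: power2_eq_square power3_eq_cube)
    then have "log 2 (real n ^ 2 + 1) \<le> log 2 (real n ^ 3)"
      by (intro log_mono) (auto simp: add_nonneg_pos)
    also have "\<dots> = 3 * l" using n by (simp add: ln_realpow log_def l_def)
    finally have "real (edge_bits n) \<le> 3 * l + 1"
      unfolding edge_bits_def using l by linarith
    then have "real (edge_bits n) \<le> 4 * l" using l by linarith
    then have "real n * real (edge_bits n) \<le> real n * (4 * l)" by (intro mult_left_mono) auto
    moreover have "2 * 1 \<le> real n * l" using n l by (intro mult_mono) auto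
    ultimately have "real (space n) \<le> 18 * (real n * l)" by (simp add: space_def)
    then show ?thesis by (simp add: l_def)
  qed
  moreover have "ln (real n) powr 1 = ln (real n)" if "2 \<le> n" for n
    using that by simp
  ultimately have "norm (real (space n)) \<le> 18 / ln 2 * norm (real n * ln (real n) powr 1)" if "2 \<le> n" for n
    using that by (simp add: abs_mult)
  then show "\<forall>\<^sub>F n in at_top. norm (real (space n)) \<le> 18 / ln 2 * norm (real n * ln (real n) powr 1)"
    using eventually_ge_at_top[of 2] by (rule eventually_mono[rotated])
qed

section \<open>Each stored set has at most as many edges as the graph has vertices\<close>

lemma ugraph_edge: "ugraph V E \<Longrightarrow> e \<in> E \<Longrightarrow> card e = 2"
  unfolding ugraph_def card_2_iff by blast

lemma ugraph_finite: "ugraph V E \<Longrightarrow> finite E"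
  unfolding ugraph_def by (rule finite_subset[of _ "Pow V"]) auto

lemma disjoint_sparse:
  assumes "ugraph V E" "X \<subseteq> E" "disjoint X"
  shows "X \<in> sparse_edge_sets V"
proof (rule sparse_edge_setsI[OF assms(1,2)])
  show mem: "(SOME v. v \<in> e) \<in> e" if "e \<in> X" for e
  proof -
    have "card e = 2" using ugraph_edge[OF assms(1)] assms(2) that by blast
    then have "e \<noteq> {}" by auto
    then show ?thesis by (simp add: some_in_eq)
  qed
  show "inj_on (\<lambda>e. SOME v. v \<in> e) X"
  proof (rule inj_onI)
    fix e f assume "e \<in> X" "f \<in> X" "(SOME v. v \<in> e) = (SOME v. v \<in> f)"
    then show "e = f" using mem[of e] mem[of f] disjointD[OF assms(3), of e f] by auto
  qed
qed

text \<open>The outer end identifies a closing edge: \<open>x\<close> determines its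
  \<open>M\<close>-partner \<open>u\<close>, and \<open>u\<close> its \<open>M0\<close>-partner
  \<open>v\<close>.\<close>

lemma closing_sparse:
  assumes "ugraph V E" "X \<subseteq> E" "disjoint M0" "disjoint M"
    and M: "\<And>e. e \<in> M \<Longrightarrow> wing (\<Union>M0) e" and X: "\<And>e. e \<in> X \<Longrightarrow> closes M0 M e"
  shows "X \<in> sparse_edge_sets V"
proof -
  have "\<exists>u v x. e = {v, x} \<and> {u, v} \<in> M0 \<and> {u, x} \<in> M" if "e \<in> X" for e
    using X[OF that] unfolding closes_def by blast
  then obtain u v x where "\<And>e. e \<in> X \<Longrightarrow> e = {v e, x e} \<and> {u e, v e} \<in> M0 \<and> {u e, x e} \<in> M"
    by metis
  then have p: "{v e, x e} = e" "{v e, u e} \<in> M0" "{u e, x e} \<in> M" if "e \<in> X" for e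
    using that by (metis, metis insert_commute, metis)
  show ?thesis
  proof (rule sparse_edge_setsI[OF assms(1,2)])
    show "x e \<in> e" if "e \<in> X" for e using p(1)[OF that] by blast
    show "inj_on x X"
    proof (rule inj_onI)
      fix e f assume ef: "e \<in> X" "f \<in> X" "x e = x f"
      have "{u f, x e} \<in> M" unfolding ef(3) by (rule p(3)[OF ef(2)])
      then have "u e = u f" by (rule disjoint_doubleton_eq[OF assms(4) p(3)[OF ef(1)]])
      then have "{v f, u e} \<in> M0" using p(2)[OF ef(2)] by simp
      then have "v e = v f" by (rule disjoint_doubleton_eq[OF assms(3) p(2)[OF ef(1)]])
      then have "{v e, x e} = {v f, x f}" using ef(3) by simp
      then show "e = f" unfolding p(1)[OF ef(1)] p(1)[OF ef(2)] .
    qed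
  qed
qed

lemma extending_sparse:
  assumes "ugraph V E" "X \<subseteq> E"
    and X: "\<And>s. s \<in> X \<Longrightarrow> \<exists>i y. extends M0 M C i y s"
    and unique: "\<And>s t i. \<lbrakk>s \<in> X; t \<in> X; i \<in> M0; s \<inter> i \<noteq> {}; t \<inter> i \<noteq> {}\<rbrakk> \<Longrightarrow> s = t"
  shows "X \<in> sparse_edge_sets V"
proof -
  have "\<exists>i w. i \<in> M0 \<and> w \<in> i \<and> w \<in> s" if "s \<in> X" for s
    using X[OF that] unfolding extends_def by blast
  then obtain i w where p: "\<And>s. s \<in> X \<Longrightarrow> i s \<in> M0 \<and> w s \<in> i s \<and> w s \<in> s" by metis
  show ?thesis
  proof (rule sparse_edge_setsI[OF assms(1,2)])
    show "w s \<in> s" if "s \<in> X" for s using p[OF that] by blast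
    show "inj_on w X"
    proof (rule inj_onI)
      fix s t assume st: "s \<in> X" "t \<in> X" "w s = w t"
      have "w s \<in> s \<inter> i s" "w s \<in> t \<inter> i s" using p[OF st(1)] p[OF st(2)] st(3) by auto
      then show "s = t" using unique[OF st(1,2), of "i s"] p[OF st(1)] by blast
    qed
  qed
qed

lemma empty_sparse: "{} \<in> sparse_edge_sets V"
  by (simp add: sparse_edge_sets_def)

section \<open>The run on a fixed graph and stream\<close>

context
  fixes V :: "'v set" and E es
  assumes graph: "ugraph V E" and stream: "edge_stream E es"
begin

definition "stored1 = foldl greedy_step {} es"

definition "stored2 = foldl (wing_step stored1) ({}, {}) es"

definition "stored3 = foldl (extend_step stored1 (fst stored2) (snd stored2)) {} es"

lemma set_es: "set es = E" "set (take j es) \<subseteq> E" "{} \<notin> set (take j es)" "{} \<notin> set es"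
proof -
  show es: "set es = E" using stream by (simp add: edge_stream_def)
  then show sub: "set (take j es) \<subseteq> E" using set_take_subset[of j es] by simp
  have "{} \<notin> E" using ugraph_edge[OF graph, of "{}"] by auto
  then show "{} \<notin> set (take j es)" "{} \<notin> set es" using sub es by auto
qed

lemma stored1: "stored1 \<subseteq> E" "disjoint stored1"
  using greedy_pass(1,2)[OF set_es(4)] set_es(1) by (simp_all add: stored1_def)

lemma three_passes_stored: "three_passes E stored1 (fst stored2) (snd stored2) stored3"
proof -
  have st2: "foldl (wing_step stored1) ({}, {}) es = (fst stored2, snd stored2)"
    by (simp add: stored2_def)
  have st3: "foldl (extend_step stored1 (fst stored2) (snd stored2)) {} es = stored3"
    by (simp add: stored3_def)
  note w = wing_pass[OF st2, unfolded set_es(1)]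
  note x = extend_pass[OF stored1(2) st3, unfolded set_es(1)]
  show ?thesis
  proof
    show "e \<inter> \<Union>stored1 \<noteq> {}" if "e \<in> E" for e
      using greedy_pass(3)[OF set_es(4), of e] that set_es(1) by (simp add: stored1_def)
  qed (fact ugraph_finite[OF graph] ugraph_edge[OF graph] stored1 w x)+
qed

definition "passes i = ((\<lambda>st. next_pass (foldl pass_step st es)) ^^ i) (0, {}, {}, {}, {})"

lemma passes:
  "passes 0 = (0, {}, {}, {}, {})"
  "passes (Suc 0) = (Suc 0, stored1, {}, {}, {})"
  "passes (Suc (Suc 0)) = (Suc (Suc 0), stored1, fst stored2, snd stored2, {})"
  "passes 3 = (3, stored1, fst stored2, snd stored2, stored3)"
proof -
  show 0: "passes 0 = (0, {}, {}, {}, {})" by (simp add: passes_def)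
  have Suc: "passes (Suc i) = next_pass (foldl pass_step (passes i) es)" for i by (simp add: passes_def)
  show 1: "passes (Suc 0) = (Suc 0, stored1, {}, {}, {})"
    by (simp only: Suc 0 foldl_pass_step next_pass.simps stored1_def)
  show 2: "passes (Suc (Suc 0)) = (Suc (Suc 0), stored1, fst stored2, snd stored2, {})"
    by (simp only: Suc[of "Suc 0"] 1 foldl_pass_step) (simp add: stored2_def split_beta Let_def)
  show "passes 3 = (3, stored1, fst stored2, snd stored2, stored3)"
    by (simp only: numeral_3_eq_3 Suc[of "Suc (Suc 0)"] 2 foldl_pass_step next_pass.simps stored3_def)
qed

lemma stored_sparse:
  "stored1 \<in> sparse_edge_sets V" "fst stored2 \<in> sparse_edge_sets V" "snd stored2 \<in> sparse_edge_sets V"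
  "stored3 \<in> sparse_edge_sets V"
proof -
  interpret three_passes E stored1 "fst stored2" "snd stored2" stored3 by (rule three_passes_stored)
  show "stored1 \<in> sparse_edge_sets V" by (rule disjoint_sparse[OF graph M0])
  show "fst stored2 \<in> sparse_edge_sets V" by (rule disjoint_sparse[OF graph M])
  show "snd stored2 \<in> sparse_edge_sets V"
    by (rule closing_sparse[OF graph C M0(2) M(2) M_wing C_closes])
  show "stored3 \<in> sparse_edge_sets V" by (rule extending_sparse[OF graph S S_extends S_unique])
qed

text \<open>The pass lemmas hold for any list of edges, so they apply to the prefix
  \<open>take j es\<close> read so far, while the sets of completed passes come from the whole
  stream.\<close>

lemma memory_states:
  assumes "i < 3"
  shows "foldl pass_step (passes i) (take j es) \<in> memories V"
proof -
  consider "i = 0" | "i = Suc 0" | "i = Suc (Suc 0)" using assms by linarith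
  then show ?thesis
  proof cases
    case 1
    note g = greedy_pass[OF set_es(3)[of j]]
    have "foldl greedy_step {} (take j es) \<in> sparse_edge_sets V"
      using g(1) set_es(2)[of j] by (intro disjoint_sparse[OF graph _ g(2)]) blast
    then show ?thesis by (simp add: 1 passes foldl_pass_step memories_def empty_sparse)
  next
    case 2
    obtain M C where MC: "foldl (wing_step stored1) ({}, {}) (take j es) = (M, C)" by fastforce
    note w = wing_pass[OF MC]
    have "M \<in> sparse_edge_sets V"
      using w(1) set_es(2)[of j] by (intro disjoint_sparse[OF graph _ w(2)]) blast
    moreover have "C \<in> sparse_edge_sets V"
      using w(5) set_es(2)[of j] by (intro closing_sparse[OF graph _ stored1(2) w(2) w(3) w(6)]) blast+
    ultimately show ?thesis
      using stored_sparse(1) by (simp add: 2 passes foldl_pass_step memories_def empty_sparse MC)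
  next
    case 3
    note x = extend_pass[OF stored1(2), where M = "fst stored2" and C = "snd stored2" and es = "take j es",
      OF refl]
    have "foldl (extend_step stored1 (fst stored2) (snd stored2)) {} (take j es) \<in> sparse_edge_sets V"
      using x(1) set_es(2)[of j] by (intro extending_sparse[OF graph _ x(2) x(3)]) blast+
    then show ?thesis
      using stored_sparse by (simp add: 3 passes foldl_pass_step memories_def)
  qed
qed

lemma final_memory: "passes 3 \<in> memories V"
  using stored_sparse by (simp add: passes memories_def)

lemma best_matching_passes:
  "maximum_matching (stored1 \<union> fst stored2 \<union> snd stored2 \<union> stored3) (best_matching (passes 3))"
proof -
  interpret three_passes E stored1 "fst stored2" "snd stored2" stored3 by (rule three_passes_stored)
  have "finite (stored1 \<union> fst stored2 \<union> snd stored2 \<union> stored3)" using finite_stored by simp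
  then have "\<exists>R. maximum_matching (stored1 \<union> fst stored2 \<union> snd stored2 \<union> stored3) R"
    by (rule exists_maximum_matching)
  then show ?thesis unfolding passes best_matching.simps by (rule someI_ex)
qed

lemma matching_best_matching: "matching E (best_matching (passes 3))"
proof -
  interpret three_passes E stored1 "fst stored2" "snd stored2" stored3 by (rule three_passes_stored)
  have "stored1 \<union> fst stored2 \<union> snd stored2 \<union> stored3 \<subseteq> E" using M0(1) M(1) C S by simp
  then show ?thesis
    using best_matching_passes unfolding maximum_matching_def matching_iff_disjoint
    by (meson order_trans)
qed

lemma best_matching_ratio:
  assumes "matching E N"
  shows "15 * card N \<le> 26 * card (best_matching (passes 3))"
proof -
  interpret three_passes E stored1 "fst stored2" "snd stored2" stored3 by (rule three_passes_stored)
  show ?thesis by (rule ratio[OF assms best_matching_passes])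
qed

end

theorem theorem4:
  "\<exists>A :: 'v streaming_algorithm.
     semi_streaming 3 A \<and>
     (\<forall>V E es. ugraph V E \<and> edge_stream E es \<longrightarrow>
        matching E (result 3 A V es) \<and>
        (\<forall>M. maximum_matching E M \<longrightarrow>
           real (card (result 3 A V es)) \<ge> (1/2 + 1/14.4) * real (card M)))"
proof -
  have "\<exists>A :: 'v streaming_algorithm. uses_space 3 A space \<and>
    (\<forall>V E es. ugraph V E \<and> edge_stream E es \<longrightarrow> result 3 A V es =
      best_matching (((\<lambda>st. next_pass (foldl pass_step st es)) ^^ 3) (0, {}, {}, {}, {})))"
  proof (rule exists_streaming_algorithm[where states = memories and init = "\<lambda>V. (0, {}, {}, {}, {})"
        and step = "\<lambda>V. pass_step" and fin = "\<lambda>V. next_pass" and out = "\<lambda>V. best_matching"], goal_cases)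
    case (1 V)
    then show ?case by (rule card_memories)
  next
    case (2 V E es i j)
    then show ?case using memory_states[of V E es i j] by (simp add: passes_def[of V E es])
  next
    case (3 V E es)
    then show ?case using final_memory[of V E es] by (simp add: passes_def[of V E es])
  qed
  then obtain A :: "'v streaming_algorithm" where space: "uses_space 3 A space"
    and run: "\<forall>V E es. ugraph V E \<and> edge_stream E es \<longrightarrow> result 3 A V es =
      best_matching (((\<lambda>st. next_pass (foldl pass_step st es)) ^^ 3) (0, {}, {}, {}, {}))"
    by (elim exE conjE)
  have result: "result 3 A V es = best_matching (passes es 3)"
    if "ugraph V E" "edge_stream E es" for V E es
    unfolding passes_def[OF that] using run that by simp
  have "semi_streaming 3 A"
    unfolding semi_streaming_def using space space_bigo zero_le_one by blast
  moreover have "real (card (result 3 A V es)) \<ge> (1/2 + 1/14.4) * real (card M)"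
    if g: "ugraph V E" "edge_stream E es" and M: "maximum_matching E M" for V E es M
  proof -
    have "15 * card M \<le> 26 * card (result 3 A V es)"
      using best_matching_ratio[OF g] M result[OF g] by (simp add: maximum_matching_def)
    then have "real (15 * card M) \<le> real (26 * card (result 3 A V es))" by (simp only: of_nat_le_iff)
    \<comment> \<open>\<open>15/26\<close> exceeds \<open>1/2 + 1/14.4 = 41/72\<close>, because 15
      times 72 is 1080 and 26 times 41 is 1066.\<close>
    then show ?thesis by simp
  qed
  moreover have "matching E (result 3 A V es)" if "ugraph V E" "edge_stream E es" for V E es
    unfolding result[OF that] by (rule matching_best_matching[OF that])
  ultimately show ?thesis by blast
qed

end
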